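(* Let $\mathbb{S}^3\subset\mathbb{H}$ be the set of unit quaternions and equip $\mathbb{S}^3\times\mathbb{S}^3$ with the nearly Kähler metric $g$. The geodesic lines on $(\mathbb{S}^3\times\mathbb{S}^3,g)$ through the point $(1,1)$ have the following parametrization: (1) $\gamma(t)=(\cos(at)+\sin(at)i,\ \cos(at)-\sin(at)i)$, $a\in\mathbb{R}\setminus\{0\}$; (2) $\gamma(t)=(\cos(at)+\sin(at)i,\ \cos(\tilde a t)+\sin(\tilde a t)i)$, where $c_1\in\mathrm{Im}\,\mathbb{H}\setminus\{0\}$, $d_1\in\mathbb{R}$, $a=\frac{1+d_1}{2}\|c_1\|$, $\tilde a=\frac{1-d_1}{2}\|c_1\|$; (3) $\gamma(t)=(x(t),y(t))$ with $$x(t)=\Big(\tfrac{1}{1+\varphi^2}\cos(At)+\tfrac{\varphi^2}{1+\varphi^2}\cos(Bt)\Big)+\Big(\tfrac{1}{1+\varphi^2}\sin(At)+\tfrac{\varphi^2}{1+\varphi^2}\sin(Bt)\Big)i$$ $$\qquad+\Big(\tfrac{\varphi}{1+\varphi^2}\sin(At)-\tfrac{\varphi}{1+\varphi^2}\sin(Bt)\Big)j-\Big(-\tfrac{\varphi}{1+\varphi^2}\cos(At)+\tfrac{\varphi}{1+\varphi^2}\cos(Bt)\Big)k,$$ $$y(t)=\Big(\tfrac{1}{1+\tilde\varphi^2}\cos(\tilde At)+\tfrac{\tilde\varphi^2}{1+\tilde\varphi^2}\cos(\tilde Bt)\Big)+\Big(\tfrac{1}{1+\tilde\varphi^2}\sin(\tilde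 At)+\tfrac{\tilde\varphi^2}{1+\tilde\varphi^2}\sin(\tilde Bt)\Big)i$$ $$\qquad+\Big(\tfrac{\tilde\varphi}{1+\tilde\varphi^2}\sin(\tilde At)-\tfrac{\tilde\varphi}{1+\tilde\varphi^2}\sin(\tilde Bt)\Big)j-\Big(-\tfrac{\tilde\varphi}{1+\tilde\varphi^2}\cos(\tilde At)+\tfrac{\tilde\varphi}{1+\tilde\varphi^2}\cos(\tilde Bt)\Big)k,$$ where $c_1,c_2\in\mathrm{Im}\,\mathbb{H}\setminus\{0\}$, $d_1\in\mathbb{R}$, $$a=\tfrac{1+d_1}{2}\|c_1\|,\quad b=\tfrac12\|c_2\|,\quad c=\tfrac23\|c_1\|,\quad \tilde a=\tfrac{1-d_1}{2}\|c_1\|,\quad \tilde b=-\tfrac12\|c_2\|,\quad \tilde c=c,$$ $$A=\frac{c+\sqrt{(2a-c)^2+4b^2}}{2},\quad B=\frac{c-\sqrt{(2a-c)^2+4b^2}}{2},$$ $$\tilde A=\frac{\tilde c+\sqrt{(2\tilde a-\tilde c)^2+4\tilde b^2}}{2},\quad \tilde B=\frac{\tilde c-\sqrt{(2\tilde a-\tilde c)^2+4\tilde b^2}}{2},$$ $$\varphi=\frac{c-2a+\sqrt{(c-2a)^2+4b^2}}{2b},\quad \tilde\varphi=\frac{\tilde c-2\tilde a+\sqrt{(\tilde c-2\tilde a)^2+4\tilde b^2}}{2\tilde b}.$$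
   Context: $\mathbb{H}$ denotes the quaternions with imaginary units $i,j,k$, $\mathrm{Im}\,\mathbb{H}$ the imaginary quaternions, and $\|\cdot\|$, $\langle\cdot,\cdot\rangle$ the Euclidean norm and inner product on $\mathbb{H}\cong\mathbb{R}^4$. $\mathbb{S}^3$ is the set of unit quaternions, and $T_p\mathbb{S}^3=p\,\mathrm{Im}\,\mathbb{H}$. Tangent vectors of $\mathbb{S}^3\times\mathbb{S}^3$ at $(p,q)$ are written $Z=(U,V)$ with $U\in T_p\mathbb{S}^3$, $V\in T_q\mathbb{S}^3$. The nearly Kähler structure on $\mathbb{S}^3\times\mathbb{S}^3$ consists of the almost complex structure $J(U,V)_{(p,q)}=\frac{1}{\sqrt3}(2pq^{-1}V-U,\,-2qp^{-1}U+V)$ and the Riemannian metric $$g(Z,Z')=\tfrac12\big(\langle Z,Z'\rangle+\langle JZ,JZ'\rangle\big)=\tfrac43\big(\langle U,U'\rangle+\langle V,V'\rangle\big)-\tfrac23\big(\langle p^{-1}U,q^{-1}V'\rangle+\langle p^{-1}U',q^{-1}V\rangle\big)$$ for $Z=(U,V)$, $Z'=(U',V')$ in $T_{(p,q)}(\mathbb{S}^3\times\mathbb{S}^3)$, where $\langle Z,Z'\rangle$ is the Euclidean product metric. Geodesic lines are taken with respect to the Levi-Civita connection of $g$; the parametrizations have constant, not necessarily unit, speed.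
   Formalization: With i, j, k fixed the list misses geodesics such as (cos t + sin t j, cos t − sin t j); the formal statement classifies the nonconstant geodesics through (1,1) up to replacing i, j, k by hih⁻¹, hjh⁻¹, hkh⁻¹ for a unit quaternion h. *)

theory Defs
  imports "HOL-Analysis.Analysis"
begin

section \<open>Quaternions\<close>

datatype quat = Quat (qRe: real) (qIm1: real) (qIm2: real) (qIm3: real)

lemma quat_eq_iff:
  "x = y \<longleftrightarrow> qRe x = qRe y \<and> qIm1 x = qIm1 y \<and> qIm2 x = qIm2 y \<and> qIm3 x = qIm3 y"
  by (cases x; cases y) auto

instantiation quat :: real_vector
begin

definition "0 = Quat 0 0 0 0"
definition "x + y = Quat (qRe x + qRe y) (qIm1 x + qIm1 y) (qIm2 x + qIm2 y) (qIm3 x + qIm3 y)"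
definition "- x = Quat (- qRe x) (- qIm1 x) (- qIm2 x) (- qIm3 x)"
definition "x - y = Quat (qRe x - qRe y) (qIm1 x - qIm1 y) (qIm2 x - qIm2 y) (qIm3 x - qIm3 y)"
definition "r *\<^sub>R x = Quat (r * qRe x) (r * qIm1 x) (r * qIm2 x) (r * qIm3 x)"

instance
  by standard
    (auto simp: quat_eq_iff zero_quat_def plus_quat_def uminus_quat_def minus_quat_def
      scaleR_quat_def algebra_simps)

end

lemma quat_linear_sel [simp]:
  "qRe 0 = 0" "qIm1 0 = 0" "qIm2 0 = 0" "qIm3 0 = 0"
  "qRe (x + y) = qRe x + qRe y" "qIm1 (x + y) = qIm1 x + qIm1 y"
  "qIm2 (x + y) = qIm2 x + qIm2 y" "qIm3 (x + y) = qIm3 x + qIm3 y"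
  "qRe (- x) = - qRe x" "qIm1 (- x) = - qIm1 x" "qIm2 (- x) = - qIm2 x" "qIm3 (- x) = - qIm3 x"
  "qRe (x - y) = qRe x - qRe y" "qIm1 (x - y) = qIm1 x - qIm1 y"
  "qIm2 (x - y) = qIm2 x - qIm2 y" "qIm3 (x - y) = qIm3 x - qIm3 y"
  "qRe (r *\<^sub>R x) = r * qRe x" "qIm1 (r *\<^sub>R x) = r * qIm1 x"
  "qIm2 (r *\<^sub>R x) = r * qIm2 x" "qIm3 (r *\<^sub>R x) = r * qIm3 x"
  by (simp_all add: zero_quat_def plus_quat_def uminus_quat_def minus_quat_def scaleR_quat_def)

instantiation quat :: real_algebra_1
begin

definition "1 = Quat 1 0 0 0"
definition "x * y = Quat
  (qRe x * qRe y - qIm1 x * qIm1 y - qIm2 x * qIm2 y - qIm3 x * qIm3 y)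
  (qRe x * qIm1 y + qIm1 x * qRe y + qIm2 x * qIm3 y - qIm3 x * qIm2 y)
  (qRe x * qIm2 y - qIm1 x * qIm3 y + qIm2 x * qRe y + qIm3 x * qIm1 y)
  (qRe x * qIm3 y + qIm1 x * qIm2 y - qIm2 x * qIm1 y + qIm3 x * qRe y)"

instance
  by standard
    (auto simp: quat_eq_iff one_quat_def times_quat_def algebra_simps)

end

lemma quat_ring_sel [simp]:
  "qRe 1 = 1" "qIm1 1 = 0" "qIm2 1 = 0" "qIm3 1 = 0"
  "qRe (x * y) = qRe x * qRe y - qIm1 x * qIm1 y - qIm2 x * qIm2 y - qIm3 x * qIm3 y"
  "qIm1 (x * y) = qRe x * qIm1 y + qIm1 x * qRe y + qIm2 x * qIm3 y - qIm3 x * qIm2 y"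
  "qIm2 (x * y) = qRe x * qIm2 y - qIm1 x * qIm3 y + qIm2 x * qRe y + qIm3 x * qIm1 y"
  "qIm3 (x * y) = qRe x * qIm3 y + qIm1 x * qIm2 y - qIm2 x * qIm1 y + qIm3 x * qRe y"
  by (simp_all add: one_quat_def times_quat_def)

instantiation quat :: real_inner
begin

definition "x \<bullet> y = qRe x * qRe y + qIm1 x * qIm1 y + qIm2 x * qIm2 y + qIm3 x * qIm3 y"
definition "norm (x :: quat) = sqrt (x \<bullet> x)"
definition "sgn (x :: quat) = x /\<^sub>R norm x"
definition "dist (x :: quat) y = norm (x - y)"
definition "(uniformity :: (quat \<times> quat) filter) = (INF e\<in>{0<..}. principal {(x, y). dist x y < e})"
definition "open (U :: quat set) \<longleftrightarrow> (\<forall>x\<in>U. eventually (\<lambda>(x', y). x' = x \<longrightarrow> y \<in> U) uniformity)"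

instance
proof
  fix x y z :: quat and r :: real
  show "x \<bullet> y = y \<bullet> x" "(x + y) \<bullet> z = x \<bullet> z + y \<bullet> z" "(r *\<^sub>R x) \<bullet> y = r * (x \<bullet> y)" "0 \<le> x \<bullet> x"
    by (simp_all add: inner_quat_def algebra_simps)
  have "a * a + b * b + c * c + d * d = 0 \<longleftrightarrow> a = 0 \<and> b = 0 \<and> c = 0 \<and> d = 0"
    for a b c d :: real
    by (smt (verit) mult_eq_0_iff zero_le_square)
  then show "x \<bullet> x = 0 \<longleftrightarrow> x = 0"
    by (simp add: inner_quat_def quat_eq_iff)
qed (simp_all add: norm_quat_def sgn_quat_def dist_quat_def uniformity_quat_def open_quat_def)

end

instantiation quat :: real_normed_div_algebra
begin

definition "inverse x =
  Quat (qRe x) (- qIm1 x) (- qIm2 x) (- qIm3 x) /\<^sub>R (x \<bullet> x)" for x :: quat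
definition "x div y = x * inverse y" for x y :: quat

instance
proof
  fix x y :: quat
  show "x div y = x * inverse y"
    by (simp add: divide_quat_def)
  show "inverse (0 :: quat) = 0"
    by (simp add: inverse_quat_def quat_eq_iff)
  show "norm (x * y) = norm x * norm y"
    unfolding norm_quat_def real_sqrt_mult[symmetric]
    by (simp add: inner_quat_def algebra_simps)
  assume "x \<noteq> 0"
  then have nz: "x \<bullet> x \<noteq> 0"
    by simp
  let ?c = "Quat (qRe x) (- qIm1 x) (- qIm2 x) (- qIm3 x)"
  have "?c * x = (x \<bullet> x) *\<^sub>R 1" "x * ?c = (x \<bullet> x) *\<^sub>R 1"
    by (simp_all add: quat_eq_iff inner_quat_def)
  then show "inverse x * x = 1" "x * inverse x = 1"
    using nz by (simp_all add: inverse_quat_def)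
qed

end

definition qi :: quat where "qi = Quat 0 1 0 0"
definition qj :: quat where "qj = Quat 0 0 1 0"
definition qk :: quat where "qk = Quat 0 0 0 1"

lemma quat_units: "qi * qi = -1" "qj * qj = -1" "qk * qk = -1" "qi * qj = qk" "qj * qk = qi" "qk * qi = qj"
  by (simp_all add: quat_eq_iff qi_def qj_def qk_def)

definition ImH :: "quat set" where
  "ImH = {x. qRe x = 0}"


section \<open>Smooth maps, Levi-Civita connection and geodesics of embedded submanifolds\<close>

text \<open>The set \<open>U\<close> is meant to be open.  In finite dimension, continuity of the iterated
  directional derivatives is continuity of the iterated derivatives.\<close>

fun Ck_on :: "nat \<Rightarrow> 'a::real_normed_vector set \<Rightarrow> ('a \<Rightarrow> 'b::real_normed_vector) \<Rightarrow> bool" where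
  "Ck_on 0 U f \<longleftrightarrow> continuous_on U f"
| "Ck_on (Suc n) U f \<longleftrightarrow>
     f differentiable_on U \<and> (\<forall>v. Ck_on n U (\<lambda>x. frechet_derivative f (at x) v))"

text \<open>On an arbitrary subset \<open>M\<close> of the ambient space, a map is smooth if near each point of \<open>M\<close>
  it is the restriction of a smooth map on an open set.  Values of the map off \<open>M\<close> are irrelevant.\<close>

definition smooth_map_on ::
    "'a::real_normed_vector set \<Rightarrow> ('a \<Rightarrow> 'b::real_normed_vector) \<Rightarrow> bool" where
  "smooth_map_on M f \<longleftrightarrow>
     (\<forall>p\<in>M. \<exists>U F. open U \<and> p \<in> U \<and> (\<forall>n. Ck_on n U F) \<and> (\<forall>x\<in>U \<inter> M. F x = f x))"

text \<open>In the following, \<open>M\<close> is a submanifold of the ambient space, \<open>T p\<close> its tangent space at \<open>p\<close>,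
  and \<open>g p\<close> the inner product on \<open>T p\<close>.  The derivative along \<open>M\<close> below is only used in tangent
  directions; there it does not depend on the derivative chosen by \<^const>\<open>frechet_derivative\<close>.\<close>

definition deriv_along ::
    "'a::real_normed_vector set \<Rightarrow> ('a \<Rightarrow> 'b::real_normed_vector) \<Rightarrow> 'a \<Rightarrow> 'a \<Rightarrow> 'b" where
  "deriv_along M f p v = frechet_derivative f (at p within M) v"

definition vector_field_on ::
    "'a::real_normed_vector set \<Rightarrow> ('a \<Rightarrow> 'a set) \<Rightarrow> ('a \<Rightarrow> 'a) \<Rightarrow> bool" where
  "vector_field_on M T X \<longleftrightarrow> smooth_map_on M X \<and> (\<forall>p\<in>M. X p \<in> T p)"

definition lie_bracket ::
    "'a::real_normed_vector set \<Rightarrow> ('a \<Rightarrow> 'a) \<Rightarrow> ('a \<Rightarrow> 'a) \<Rightarrow> 'a \<Rightarrow> 'a" where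
  "lie_bracket M X Y p = deriv_along M Y p (X p) - deriv_along M X p (Y p)"

text \<open>\<open>nabla p v Y\<close> is the covariant derivative of the vector field \<open>Y\<close> at \<open>p\<close> in the direction
  \<open>v \<in> T p\<close>.  The congruence condition says that it depends on \<open>Y\<close> only through its restriction
  to \<open>M\<close>.\<close>

definition affine_connection ::
    "'a::real_normed_vector set \<Rightarrow> ('a \<Rightarrow> 'a set) \<Rightarrow> ('a \<Rightarrow> 'a \<Rightarrow> ('a \<Rightarrow> 'a) \<Rightarrow> 'a) \<Rightarrow> bool" where
  "affine_connection M T nabla \<longleftrightarrow>
     (\<forall>X Y. vector_field_on M T X \<longrightarrow> vector_field_on M T Y \<longrightarrow>
        vector_field_on M T (\<lambda>p. nabla p (X p) Y)) \<and>
     (\<forall>Y p v w r s. vector_field_on M T Y \<longrightarrow> p \<in> M \<longrightarrow> v \<in> T p \<longrightarrow> w \<in> T p \<longrightarrow>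
        nabla p (r *\<^sub>R v + s *\<^sub>R w) Y = r *\<^sub>R nabla p v Y + s *\<^sub>R nabla p w Y) \<and>
     (\<forall>Y Z p v. vector_field_on M T Y \<longrightarrow> vector_field_on M T Z \<longrightarrow> p \<in> M \<longrightarrow> v \<in> T p \<longrightarrow>
        nabla p v (\<lambda>x. Y x + Z x) = nabla p v Y + nabla p v Z) \<and>
     (\<forall>(f::'a \<Rightarrow> real) Y p v. smooth_map_on M f \<longrightarrow> vector_field_on M T Y \<longrightarrow> p \<in> M \<longrightarrow> v \<in> T p \<longrightarrow>
        nabla p v (\<lambda>x. f x *\<^sub>R Y x) = deriv_along M f p v *\<^sub>R Y p + f p *\<^sub>R nabla p v Y) \<and>
     (\<forall>Y Z p v. vector_field_on M T Y \<longrightarrow> vector_field_on M T Z \<longrightarrow> (\<forall>x\<in>M. Y x = Z x) \<longrightarrow>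
        p \<in> M \<longrightarrow> v \<in> T p \<longrightarrow> nabla p v Y = nabla p v Z)"

definition levi_civita_connection ::
    "'a::real_normed_vector set \<Rightarrow> ('a \<Rightarrow> 'a set) \<Rightarrow> ('a \<Rightarrow> 'a \<Rightarrow> 'a \<Rightarrow> real) \<Rightarrow>
     ('a \<Rightarrow> 'a \<Rightarrow> ('a \<Rightarrow> 'a) \<Rightarrow> 'a) \<Rightarrow> bool" where
  "levi_civita_connection M T g nabla \<longleftrightarrow>
     affine_connection M T nabla \<and>
     (\<forall>X Y p. vector_field_on M T X \<longrightarrow> vector_field_on M T Y \<longrightarrow> p \<in> M \<longrightarrow>
        nabla p (X p) Y - nabla p (Y p) X = lie_bracket M X Y p) \<and>
     (\<forall>Y Z p v. vector_field_on M T Y \<longrightarrow> vector_field_on M T Z \<longrightarrow> p \<in> M \<longrightarrow> v \<in> T p \<longrightarrow>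
        deriv_along M (\<lambda>x. g x (Y x) (Z x)) p v
          = g p (nabla p v Y) (Z p) + g p (Y p) (nabla p v Z))"

definition field_along_curve ::
    "('a::real_normed_vector \<Rightarrow> 'a set) \<Rightarrow> (real \<Rightarrow> 'a) \<Rightarrow> (real \<Rightarrow> 'a) \<Rightarrow> bool" where
  "field_along_curve T \<gamma> V \<longleftrightarrow> smooth_map_on UNIV V \<and> (\<forall>t. V t \<in> T (\<gamma> t))"

text \<open>The covariant derivative along a curve: the (unique) derivation on vector fields along
  \<open>\<gamma>\<close> which on restrictions of vector fields on \<open>M\<close> is given by the connection.\<close>

definition covariant_derivative_along ::
    "'a::real_normed_vector set \<Rightarrow> ('a \<Rightarrow> 'a set) \<Rightarrow> ('a \<Rightarrow> 'a \<Rightarrow> ('a \<Rightarrow> 'a) \<Rightarrow> 'a) \<Rightarrow>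
     (real \<Rightarrow> 'a) \<Rightarrow> ((real \<Rightarrow> 'a) \<Rightarrow> real \<Rightarrow> 'a) \<Rightarrow> bool" where
  "covariant_derivative_along M T nabla \<gamma> D \<longleftrightarrow>
     (\<forall>V. field_along_curve T \<gamma> V \<longrightarrow> field_along_curve T \<gamma> (D V)) \<and>
     (\<forall>V W t. field_along_curve T \<gamma> V \<longrightarrow> field_along_curve T \<gamma> W \<longrightarrow>
        D (\<lambda>s. V s + W s) t = D V t + D W t) \<and>
     (\<forall>(f::real \<Rightarrow> real) V t. smooth_map_on UNIV f \<longrightarrow> field_along_curve T \<gamma> V \<longrightarrow>
        D (\<lambda>s. f s *\<^sub>R V s) t = deriv f t *\<^sub>R V t + f t *\<^sub>R D V t) \<and>
     (\<forall>Y t. vector_field_on M T Y \<longrightarrow>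
        D (\<lambda>s. Y (\<gamma> s)) t = nabla (\<gamma> t) (vector_derivative \<gamma> (at t)) Y)"

definition geodesic ::
    "'a::real_normed_vector set \<Rightarrow> ('a \<Rightarrow> 'a set) \<Rightarrow> ('a \<Rightarrow> 'a \<Rightarrow> 'a \<Rightarrow> real) \<Rightarrow>
     (real \<Rightarrow> 'a) \<Rightarrow> bool" where
  "geodesic M T g \<gamma> \<longleftrightarrow>
     smooth_map_on UNIV \<gamma> \<and> range \<gamma> \<subseteq> M \<and>
     (\<exists>nabla D. levi_civita_connection M T g nabla \<and> covariant_derivative_along M T nabla \<gamma> D \<and>
        (\<forall>t. D (\<lambda>s. vector_derivative \<gamma> (at s)) t = 0))"


section \<open>The nearly Kaehler structure on the product of two unit spheres\<close>

definition S3 :: "quat set" where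
  "S3 = {p. norm p = 1}"

definition S3S3 :: "(quat \<times> quat) set" where
  "S3S3 = S3 \<times> S3"

definition tangent_S3 :: "quat \<Rightarrow> quat set" where
  "tangent_S3 p = (\<lambda>x. p * x) ` ImH"

definition tangent_S3S3 :: "quat \<times> quat \<Rightarrow> (quat \<times> quat) set" where
  "tangent_S3S3 = (\<lambda>(p, q). tangent_S3 p \<times> tangent_S3 q)"

definition nk_J :: "quat \<times> quat \<Rightarrow> quat \<times> quat \<Rightarrow> quat \<times> quat" where
  "nk_J = (\<lambda>(p, q) (U, V). (1 / sqrt 3) *\<^sub>R
     (2 *\<^sub>R (p * inverse q * V) - U, - 2 *\<^sub>R (q * inverse p * U) + V))"

definition nk_metric :: "quat \<times> quat \<Rightarrow> quat \<times> quat \<Rightarrow> quat \<times> quat \<Rightarrow> real" where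
  "nk_metric P Z Z' = 1 / 2 * (Z \<bullet> Z' + nk_J P Z \<bullet> nk_J P Z')"

lemma inner_unit_mult_left:
  fixes p x y :: quat
  assumes "norm p = 1"
  shows "(p * x) \<bullet> (p * y) = x \<bullet> y"
proof -
  have "(p * x) \<bullet> (p * y) = (p \<bullet> p) * (x \<bullet> y)"
    by (simp add: inner_quat_def algebra_simps)
  then show ?thesis
    using assms by (simp add: norm_eq_1)
qed

lemma nk_metric_explicit:
  assumes "(p, q) \<in> S3S3"
  shows "nk_metric (p, q) (U, V) (U', V') =
    4 / 3 * (U \<bullet> U' + V \<bullet> V')
    - 2 / 3 * ((inverse p * U) \<bullet> (inverse q * V') + (inverse p * U') \<bullet> (inverse q * V))"
proof -
  have n: "norm p = 1" "norm q = 1"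
    using assms by (auto simp: S3S3_def S3_def)
  then have "p \<noteq> 0" "q \<noteq> 0"
    by auto
  define u v u' v' where "u = inverse p * U" and "v = inverse q * V"
    and "u' = inverse p * U'" and "v' = inverse q * V'"
  have UV: "U = p * u" "V = q * v" "U' = p * u'" "V' = q * v'"
    using \<open>p \<noteq> 0\<close> \<open>q \<noteq> 0\<close> by (simp_all add: u_def v_def u'_def v'_def mult.assoc[symmetric])
  have J: "nk_J (p, q) (p * a, q * b) =
      (1 / sqrt 3) *\<^sub>R (p * (2 *\<^sub>R b - a), q * (b - 2 *\<^sub>R a))" for a b
    using \<open>p \<noteq> 0\<close> \<open>q \<noteq> 0\<close>
    by (simp add: nk_J_def mult.assoc right_diff_distrib)
       (simp add: mult.assoc[symmetric])
  have "nk_metric (p, q) (U, V) (U', V') = 1 / 2 * (u \<bullet> u' + v \<bullet> v'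
      + 1 / 3 * ((2 *\<^sub>R v - u) \<bullet> (2 *\<^sub>R v' - u') + (v - 2 *\<^sub>R u) \<bullet> (v' - 2 *\<^sub>R u')))"
    unfolding nk_metric_def UV J inner_scaleR_left inner_scaleR_right
    by (simp add: inner_unit_mult_left n)
  also have "\<dots> = 4 / 3 * (u \<bullet> u' + v \<bullet> v') - 2 / 3 * (u \<bullet> v' + u' \<bullet> v)"
    by (simp add: inner_diff_left inner_diff_right inner_commute algebra_simps)
  also have "\<dots> = 4 / 3 * (U \<bullet> U' + V \<bullet> V')
    - 2 / 3 * ((inverse p * U) \<bullet> (inverse q * V') + (inverse p * U') \<bullet> (inverse q * V))"
    by (simp add: UV inner_unit_mult_left n)
       (simp add: u_def[symmetric] v_def[symmetric] u'_def[symmetric] v'_def[symmetric]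
          UV[symmetric])
  finally show ?thesis .
qed

definition geodesic_line :: "(real \<Rightarrow> quat \<times> quat) \<Rightarrow> bool" where
  "geodesic_line \<gamma> \<longleftrightarrow>
     geodesic S3S3 tangent_S3S3 nk_metric \<gamma> \<and> \<not> (\<exists>P. \<forall>t. \<gamma> t = P)"


section \<open>The three families of curves\<close>

definition family1 :: "(real \<Rightarrow> quat \<times> quat) set" where
  "family1 = {\<gamma>. \<exists>a::real. a \<noteq> 0 \<and>
     \<gamma> = (\<lambda>t. (of_real (cos (a * t)) + sin (a * t) *\<^sub>R qi, of_real (cos (a * t)) - sin (a * t) *\<^sub>R qi))}"

definition family2 :: "(real \<Rightarrow> quat \<times> quat) set" where
  "family2 = {\<gamma>. \<exists>c1\<in>ImH - {0}. \<exists>d1 a a'::real.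
     a = (1 + d1) / 2 * norm c1 \<and> a' = (1 - d1) / 2 * norm c1 \<and>
     \<gamma> = (\<lambda>t. (of_real (cos (a * t)) + sin (a * t) *\<^sub>R qi,
                of_real (cos (a' * t)) + sin (a' * t) *\<^sub>R qi))}"

text \<open>The two components of a curve of the third kind have the same shape, given by \<open>curve3\<close>.\<close>

definition curve3 :: "real \<Rightarrow> real \<Rightarrow> real \<Rightarrow> real \<Rightarrow> quat" where
  "curve3 \<phi> A B t =
     of_real (1 / (1 + \<phi>\<^sup>2) * cos (A * t) + \<phi>\<^sup>2 / (1 + \<phi>\<^sup>2) * cos (B * t))
     + (1 / (1 + \<phi>\<^sup>2) * sin (A * t) + \<phi>\<^sup>2 / (1 + \<phi>\<^sup>2) * sin (B * t)) *\<^sub>R qi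
     + (\<phi> / (1 + \<phi>\<^sup>2) * sin (A * t) - \<phi> / (1 + \<phi>\<^sup>2) * sin (B * t)) *\<^sub>R qj
     - (- \<phi> / (1 + \<phi>\<^sup>2) * cos (A * t) + \<phi> / (1 + \<phi>\<^sup>2) * cos (B * t)) *\<^sub>R qk"

definition family3 :: "(real \<Rightarrow> quat \<times> quat) set" where
  "family3 = {\<gamma>. \<exists>c1\<in>ImH - {0}. \<exists>c2\<in>ImH - {0}. \<exists>d1 a b c a' b' c' A B A' B' \<phi> \<phi>'::real.
     a = (1 + d1) / 2 * norm c1 \<and> b = 1 / 2 * norm c2 \<and> c = 2 / 3 * norm c1 \<and>
     a' = (1 - d1) / 2 * norm c1 \<and> b' = - 1 / 2 * norm c2 \<and> c' = c \<and>
     A = (c + sqrt ((2 * a - c)\<^sup>2 + 4 * b\<^sup>2)) / 2 \<and>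
     B = (c - sqrt ((2 * a - c)\<^sup>2 + 4 * b\<^sup>2)) / 2 \<and>
     A' = (c' + sqrt ((2 * a' - c')\<^sup>2 + 4 * b'\<^sup>2)) / 2 \<and>
     B' = (c' - sqrt ((2 * a' - c')\<^sup>2 + 4 * b'\<^sup>2)) / 2 \<and>
     \<phi> = (c - 2 * a + sqrt ((c - 2 * a)\<^sup>2 + 4 * b\<^sup>2)) / (2 * b) \<and>
     \<phi>' = (c' - 2 * a' + sqrt ((c' - 2 * a')\<^sup>2 + 4 * b'\<^sup>2)) / (2 * b') \<and>
     \<gamma> = (\<lambda>t. (curve3 \<phi> A B t, curve3 \<phi>' A' B' t))}"

text \<open>Simultaneous conjugation by a unit quaternion \<open>h\<close>: an isometry fixing \<open>(1, 1)\<close>, which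
  replaces the imaginary units \<open>i, j, k\<close> by the units \<open>h i h\<^sup>-\<^sup>1, h j h\<^sup>-\<^sup>1, h k h\<^sup>-\<^sup>1\<close>.  Every
  positively oriented orthonormal basis of the imaginary quaternions arises in this way.\<close>

definition conj_pair :: "quat \<Rightarrow> quat \<times> quat \<Rightarrow> quat \<times> quat" where
  "conj_pair h = (\<lambda>(p, q). (h * p * inverse h, h * q * inverse h))"

end

theory Submission
  imports Defs
begin

text \<open>The metric is left-invariant on the Lie group \<open>S\<^sup>3 \<times> S\<^sup>3\<close>.  Writing the velocity of a curve
  \<open>(x, y)\<close> as \<open>x' = x \<alpha>\<close>, \<open>y' = y \<beta>\<close> with imaginary \<open>\<alpha>, \<beta>\<close>, the geodesic equation becomes
  \<open>\<alpha>' = - \<beta>' = [\<alpha>, \<beta>] / 3\<close>.  Hence \<open>c\<^sub>1 = \<alpha> + \<beta>\<close> is constant and \<open>\<alpha> - \<beta>\<close> rotates about \<open>c\<^sub>1\<close>; the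
  three families correspond to \<open>c\<^sub>1 = 0\<close>, to \<open>\<alpha> - \<beta>\<close> parallel to \<open>c\<^sub>1 \<noteq> 0\<close>, and to \<open>\<alpha> - \<beta> = d\<^sub>1 c\<^sub>1 + c\<^sub>2\<close>
  with \<open>c\<^sub>2 \<noteq> 0\<close> initially orthogonal to \<open>c\<^sub>1\<close>.  Conjugation moves \<open>c\<^sub>1\<close> and \<open>c\<^sub>2\<close> onto multiples of \<open>i\<close> and \<open>j\<close>,
  and solutions are determined by their initial velocity.\<close>

section \<open>Calculus of smooth maps\<close>

text \<open>\<open>geodesic\<close> asserts that some connection and some covariant derivative
  exist, both characterised only by axioms. This makes the two directions of the equivalence with
  the Euler-Arnold system quite different: one builds the explicit witnesses \<open>nk_nabla\<close>
  and \<open>nk_covariant\<close> and checks every axiom; the other extracts the equation from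
  arbitrary ones, which works because torsion-freeness and metric compatibility fix any Levi-Civita
  connection on left-invariant fields, and these fields form a global frame. An obstacle underneath
  is that a derivative within \<open>S3S3\<close> is determined on tangent vectors only, while
  \<open>frechet_derivative\<close> makes an arbitrary choice elsewhere; values are therefore
  identified by testing along curves in \<open>S3S3\<close> (\<open>deriv_along_eq\<close>). No
  existence theorem for differential equations is invoked: the explicit curves attain every nonzero
  initial velocity, and uniqueness follows from quantities conserved by the equations.\<close>

lemma Ck_on_cong:
  assumes "open U" "\<And>x. x \<in> U \<Longrightarrow> f x = g x" "Ck_on n U f"
  shows "Ck_on n U g"
  using assms(2,3)
proof (induction n arbitrary: f g)
  case 0
  then show ?case using continuous_on_cong by force
next
  case (Suc n)
  have diff: "f differentiable at x" if "x \<in> U" for x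
    using Suc.prems(2) that \<open>open U\<close> by (auto simp: differentiable_on_eq_differentiable_at)
  have eq: "frechet_derivative f (at x) = frechet_derivative g (at x)" if "x \<in> U" for x
    using frechet_derivative_transform_within_open[OF diff[OF that] \<open>open U\<close> that Suc.prems(1)] .
  have "g differentiable at x" if "x \<in> U" for x
    using has_derivative_transform_within_open[OF diff[OF that, unfolded frechet_derivative_works]
        \<open>open U\<close> that Suc.prems(1)]
    by (rule differentiableI)
  then have "g differentiable_on U"
    by (simp add: differentiable_at_imp_differentiable_on)
  moreover have "Ck_on n U (\<lambda>x. frechet_derivative g (at x) v)" for v
    using Suc.IH[of "\<lambda>x. frechet_derivative f (at x) v"] Suc.prems(2) eq by simp
  ultimately show ?case by simp
qed

lemma Ck_on_has_derivative:
  assumes "open U" "Ck_on (Suc n) U f" "x \<in> U"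
  shows "(f has_derivative frechet_derivative f (at x)) (at x)"
  using assms by (auto simp: differentiable_on_eq_differentiable_at frechet_derivative_works[symmetric])

text \<open>Derivatives at points of an open set are unique, so any convenient formula
  \<open>F\<close> may stand in for the choice made by \<open>frechet_derivative\<close>.\<close>

lemma Ck_on_SucI:
  assumes "open U" "\<And>x. x \<in> U \<Longrightarrow> (f has_derivative F x) (at x)" "\<And>v. Ck_on n U (\<lambda>x. F x v)"
  shows "Ck_on (Suc n) U f"
proof -
  have "f differentiable_on U"
    using assms(2) by (meson differentiableI differentiable_at_imp_differentiable_on)
  moreover have "Ck_on n U (\<lambda>x. frechet_derivative f (at x) v)" for v
    by (rule Ck_on_cong[OF assms(1) _ assms(3)[of v]])
       (simp add: frechet_derivative_at[OF assms(2), symmetric])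
  ultimately show ?thesis by simp
qed

lemma Ck_on_SucD: "open U \<Longrightarrow> Ck_on (Suc n) U f \<Longrightarrow> Ck_on n U f"
  by (induction n arbitrary: f) (auto simp: differentiable_imp_continuous_on)

lemma Ck_on_open_subset:
  assumes "open U" "open V" "V \<subseteq> U" "Ck_on n U f"
  shows "Ck_on n V f"
  using assms(4)
  by (induction n arbitrary: f)
     (use assms(3) in \<open>auto intro: continuous_on_subset differentiable_on_subset\<close>)

lemma Ck_on_const: "Ck_on n U (\<lambda>x. c)"
  by (induction n arbitrary: c) (auto simp: frechet_derivative_const)

lemma Ck_on_add:
  assumes "open U" "Ck_on n U f" "Ck_on n U g"
  shows "Ck_on n U (\<lambda>x. f x + g x)"
  using assms(2,3)
proof (induction n arbitrary: f g)
  case 0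
  then show ?case by (simp add: continuous_on_add)
next
  case (Suc n)
  show ?case
    by (rule Ck_on_SucI[OF assms(1) has_derivative_add[OF Ck_on_has_derivative[OF assms(1) Suc.prems(1)]
          Ck_on_has_derivative[OF assms(1) Suc.prems(2)]]])
       (use Suc in auto)
qed

lemma Ck_on_sum:
  assumes "open U" "finite I" "\<And>i. i \<in> I \<Longrightarrow> Ck_on n U (f i)"
  shows "Ck_on n U (\<lambda>x. \<Sum>i\<in>I. f i x)"
  using assms(2,3) by (induction I) (auto intro: Ck_on_const Ck_on_add[OF assms(1)])

lemma Ck_on_bounded_linear:
  assumes h: "bounded_linear h" and U: "open U" and "Ck_on n U f"
  shows "Ck_on n U (\<lambda>x. h (f x))"
  using assms(3)
proof (induction n arbitrary: f)
  case 0
  then show ?case by (simp add: bounded_linear.continuous_on[OF h])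
next
  case (Suc n)
  show ?case
    by (rule Ck_on_SucI[OF U bounded_linear.has_derivative[OF h Ck_on_has_derivative[OF U Suc.prems]]])
       (use Suc in auto)
qed

lemma Ck_on_bounded_bilinear:
  assumes h: "bounded_bilinear h" and U: "open U" and "Ck_on n U f" "Ck_on n U g"
  shows "Ck_on n U (\<lambda>x. h (f x) (g x))"
  using assms(3,4)
proof (induction n arbitrary: f g)
  case 0
  then show ?case by (simp add: bounded_bilinear.continuous_on[OF h])
next
  case (Suc n)
  \<comment> \<open>The product rule leaves \<open>f\<close> and \<open>g\<close> undifferentiated
    in each summand; \<open>Ck_on_SucD\<close> lowers their order to match.\<close>
  show ?case
    by (rule Ck_on_SucI[OF U bounded_bilinear.FDERIV[OF h
          Ck_on_has_derivative[OF U Suc.prems(1)] Ck_on_has_derivative[OF U Suc.prems(2)]]])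
       (use Suc Ck_on_SucD[OF U Suc.prems(1)] Ck_on_SucD[OF U Suc.prems(2)] in
         \<open>auto intro!: Ck_on_add[OF U]\<close>)
qed

lemma Ck_on_linear_self:
  assumes "bounded_linear h" "open U"
  shows "Ck_on n U h"
proof (cases n)
  case 0
  then show ?thesis by (simp add: bounded_linear.continuous_on[OF assms(1)])
next
  case (Suc m)
  have "Ck_on (Suc m) U h"
    by (rule Ck_on_SucI[OF assms(2) bounded_linear_imp_has_derivative[OF assms(1)]]) (rule Ck_on_const)
  then show ?thesis using Suc by simp
qed

text \<open>\<open>Ck_on\<close> speaks of derivatives in fixed directions, while here the direction
  moves with the point. Expanding \<open>v x\<close> in finitely many fixed directions turns the
  expression into a finite sum of products. The expansion is a hypothesis because the domain is only
  assumed to be an inner product space.\<close>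

lemma Ck_on_frechet_derivative_apply:
  fixes f :: "'a::real_inner \<Rightarrow> 'b::real_normed_vector"
  assumes U: "open U" and f: "Ck_on (Suc n) U f" and v: "Ck_on n U v"
    and B: "finite B" "\<And>w::'a. w = (\<Sum>b\<in>B. (w \<bullet> b) *\<^sub>R b)"
  shows "Ck_on n U (\<lambda>x. frechet_derivative f (at x) (v x))"
proof -
  have eq: "(\<Sum>b\<in>B. (v x \<bullet> b) *\<^sub>R frechet_derivative f (at x) b) = frechet_derivative f (at x) (v x)"
    if "x \<in> U" for x
  proof -
    have "linear (frechet_derivative f (at x))"
      using Ck_on_has_derivative[OF U f that] has_derivative_linear by blast
    then have "frechet_derivative f (at x) (\<Sum>b\<in>B. (v x \<bullet> b) *\<^sub>R b)
        = (\<Sum>b\<in>B. (v x \<bullet> b) *\<^sub>R frechet_derivative f (at x) b)"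
      by (simp add: linear_sum linear_scale)
    then show ?thesis using B(2)[of "v x"] by simp
  qed
  show ?thesis
    by (rule Ck_on_cong[OF U eq], assumption)
       (use f in \<open>auto intro!: Ck_on_sum[OF U B(1)] Ck_on_bounded_bilinear[OF bounded_bilinear_scaleR U]
          Ck_on_bounded_linear[OF bounded_linear_inner_left U v]\<close>)
qed

section \<open>Smooth maps on subsets of the ambient space\<close>

lemma smooth_map_onE:
  assumes "smooth_map_on M f" "p \<in> M"
  obtains U F where "open U" "p \<in> U" "\<And>n. Ck_on n U F" "\<And>x. x \<in> U \<Longrightarrow> x \<in> M \<Longrightarrow> F x = f x"
  using assms unfolding smooth_map_on_def by (metis IntI)

lemma smooth_map_onI:
  assumes "\<And>p. p \<in> M \<Longrightarrow> \<exists>U F. open U \<and> p \<in> U \<and> (\<forall>n. Ck_on n U F) \<and> (\<forall>x\<in>U \<inter> M. F x = f x)"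
  shows "smooth_map_on M f"
  using assms unfolding smooth_map_on_def by blast

lemma smooth_map_on_Ck: "(\<And>n. Ck_on n UNIV f) \<Longrightarrow> smooth_map_on M f"
  by (rule smooth_map_onI) (metis UNIV_I open_UNIV)

lemma smooth_map_on_const: "smooth_map_on M (\<lambda>x. c)"
  by (rule smooth_map_on_Ck) (rule Ck_on_const)

lemma smooth_map_on_linear_self: "bounded_linear h \<Longrightarrow> smooth_map_on M h"
  by (rule smooth_map_on_Ck) (simp add: Ck_on_linear_self)

lemma smooth_map_on_bounded_bilinear:
  assumes h: "bounded_bilinear h" and "smooth_map_on M f" "smooth_map_on M g"
  shows "smooth_map_on M (\<lambda>x. h (f x) (g x))"
proof (rule smooth_map_onI)
  fix p assume "p \<in> M"
  obtain U F where F: "open U" "p \<in> U" "\<And>n. Ck_on n U F" "\<And>x. x \<in> U \<Longrightarrow> x \<in> M \<Longrightarrow> F x = f x"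
    using smooth_map_onE[OF assms(2) \<open>p \<in> M\<close>] by blast
  obtain V G where G: "open V" "p \<in> V" "\<And>n. Ck_on n V G" "\<And>x. x \<in> V \<Longrightarrow> x \<in> M \<Longrightarrow> G x = g x"
    using smooth_map_onE[OF assms(3) \<open>p \<in> M\<close>] by blast
  have "Ck_on n (U \<inter> V) (\<lambda>x. h (F x) (G x))" for n
    by (rule Ck_on_bounded_bilinear[OF h])
       (use F G in \<open>auto intro: Ck_on_open_subset[where U=U] Ck_on_open_subset[where U=V]\<close>)
  then show "\<exists>U F. open U \<and> p \<in> U \<and> (\<forall>n. Ck_on n U F) \<and> (\<forall>x\<in>U \<inter> M. F x = h (f x) (g x))"
    using F G by (intro exI[of _ "U \<inter> V"] exI[of _ "\<lambda>x. h (F x) (G x)"]) auto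
qed

lemma smooth_map_on_bounded_linear:
  assumes h: "bounded_linear h" and f: "smooth_map_on M f"
  shows "smooth_map_on M (\<lambda>x. h (f x))"
proof (rule smooth_map_onI)
  fix p assume "p \<in> M"
  then obtain U F where U: "open U" "p \<in> U" "\<And>n. Ck_on n U F" "\<And>x. x \<in> U \<Longrightarrow> x \<in> M \<Longrightarrow> F x = f x"
    using smooth_map_onE[OF f] by blast
  then show "\<exists>U F. open U \<and> p \<in> U \<and> (\<forall>n. Ck_on n U F) \<and> (\<forall>x\<in>U \<inter> M. F x = h (f x))"
    using Ck_on_bounded_linear[OF h U(1) U(3)] by (intro exI[of _ U] exI[of _ "\<lambda>x. h (F x)"]) auto
qed

lemma smooth_map_on_Pair:
  assumes "smooth_map_on M f" "smooth_map_on M g"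
  shows "smooth_map_on M (\<lambda>x. (f x, g x))"
proof (rule smooth_map_onI)
  fix p assume "p \<in> M"
  obtain U F where F: "open U" "p \<in> U" "\<And>n. Ck_on n U F" "\<And>x. x \<in> U \<Longrightarrow> x \<in> M \<Longrightarrow> F x = f x"
    using smooth_map_onE[OF assms(1) \<open>p \<in> M\<close>] by blast
  obtain V G where G: "open V" "p \<in> V" "\<And>n. Ck_on n V G" "\<And>x. x \<in> V \<Longrightarrow> x \<in> M \<Longrightarrow> G x = g x"
    using smooth_map_onE[OF assms(2) \<open>p \<in> M\<close>] by blast
  \<comment> \<open>Writing the pair as a sum of two linear images reduces pairing to rules already
    available for \<open>Ck_on\<close>.\<close>
  have "Ck_on n (U \<inter> V) (\<lambda>x. (F x, 0) + (0, G x))" for n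
    using F G
    by (intro Ck_on_add Ck_on_bounded_linear[of "\<lambda>x. (x, 0)"] Ck_on_bounded_linear[of "\<lambda>x. (0, x)"]
        bounded_linear_Pair bounded_linear_zero bounded_linear_ident)
       (auto intro: Ck_on_open_subset[where U=U] Ck_on_open_subset[where U=V])
  then show "\<exists>U F. open U \<and> p \<in> U \<and> (\<forall>n. Ck_on n U F) \<and> (\<forall>x\<in>U \<inter> M. F x = (f x, g x))"
    using F G by (intro exI[of _ "U \<inter> V"] exI[of _ "\<lambda>x. (F x, 0) + (0, G x)"]) auto
qed

lemma smooth_map_on_add:
  assumes "smooth_map_on M f" "smooth_map_on M g"
  shows "smooth_map_on M (\<lambda>x. f x + g x)"
  using smooth_map_on_bounded_linear[OF _ smooth_map_on_Pair[OF assms], of "\<lambda>z. fst z + snd z"]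
  by (simp add: bounded_linear_add bounded_linear_fst bounded_linear_snd)

lemma smooth_map_on_sum:
  assumes "finite I" "\<And>i. i \<in> I \<Longrightarrow> smooth_map_on M (f i)"
  shows "smooth_map_on M (\<lambda>x. \<Sum>i\<in>I. f i x)"
  using assms by (induction I) (auto intro: smooth_map_on_const smooth_map_on_add)

lemmas smooth_map_on_fst = smooth_map_on_bounded_linear[OF bounded_linear_fst]
lemmas smooth_map_on_snd = smooth_map_on_bounded_linear[OF bounded_linear_snd]
lemmas smooth_map_on_minus = smooth_map_on_bounded_linear[OF bounded_linear_minus[OF bounded_linear_ident]]
lemmas smooth_map_on_scaleR = smooth_map_on_bounded_bilinear[OF bounded_bilinear_scaleR]
lemmas smooth_map_on_mult = smooth_map_on_bounded_bilinear[OF bounded_bilinear_mult]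
lemmas smooth_map_on_inner = smooth_map_on_bounded_bilinear[OF bounded_bilinear_inner]

lemma smooth_map_on_diff:
  "smooth_map_on M f \<Longrightarrow> smooth_map_on M g \<Longrightarrow> smooth_map_on M (\<lambda>x. f x - g x)"
  using smooth_map_on_add[OF _ smooth_map_on_minus, of M f g] by simp

lemmas smooth_intros = smooth_map_on_const smooth_map_on_Pair smooth_map_on_add smooth_map_on_diff
  smooth_map_on_minus smooth_map_on_fst smooth_map_on_snd smooth_map_on_scaleR smooth_map_on_mult
  smooth_map_on_inner smooth_map_on_sum

text \<open>A smooth extension \<open>F\<close> supplies one derivative of \<open>f\<close> within
  \<open>M\<close>; its values in directions normal to \<open>M\<close> depend on the
  extension.\<close>

lemma Ck_on_extension_has_derivative:
  assumes "open U" "Ck_on (Suc n) U F" "x \<in> U" "x \<in> M" "\<And>y. y \<in> U \<Longrightarrow> y \<in> M \<Longrightarrow> F y = f y"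
  shows "(f has_derivative frechet_derivative F (at x)) (at x within M)"
proof -
  have "(F has_derivative frechet_derivative F (at x)) (at x within M)"
    using Ck_on_has_derivative[OF assms(1-3)] has_derivative_at_withinI by blast
  moreover obtain d where "d > 0" "ball x d \<subseteq> U"
    using openE[OF assms(1,3)] by blast
  ultimately show ?thesis
    using assms(4,5)
    by (intro has_derivative_transform_within[of F _ x M d f]) (auto simp: subset_iff dist_commute)
qed

lemma smooth_map_on_has_derivative:
  assumes "smooth_map_on M f" "p \<in> M"
  shows "(f has_derivative frechet_derivative f (at p within M)) (at p within M)"
proof -
  obtain U F where U: "open U" "p \<in> U" "\<And>n. Ck_on n U F" "\<And>x. x \<in> U \<Longrightarrow> x \<in> M \<Longrightarrow> F x = f x"
    using smooth_map_onE[OF assms] by blast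
  show ?thesis
    using Ck_on_extension_has_derivative[OF U(1) U(3) U(2) assms(2) U(4)]
    by (meson differentiableI frechet_derivative_works)
qed

section \<open>Curves and their velocities\<close>

lemma has_vector_derivative_of_has_derivative:
  assumes "(f has_derivative F) (at t)"
  shows "(f has_vector_derivative F 1) (at t)"
proof -
  have "F x = x *\<^sub>R F 1" for x
    using linear_scale[OF has_derivative_linear[OF assms], of x 1] by simp
  then have "F = (\<lambda>x. x *\<^sub>R F 1)" by blast
  then show ?thesis using assms by (metis has_vector_derivative_def)
qed

lemma smooth_map_on_real_has_vector_derivative:
  assumes "smooth_map_on UNIV f"
  shows "(f has_vector_derivative vector_derivative f (at t)) (at t)"
  using has_vector_derivative_of_has_derivative[OF smooth_map_on_has_derivative[OF assms UNIV_I]]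
  by (metis vector_derivative_at)

lemma has_vector_derivative_compose_within:
  assumes c: "(c has_vector_derivative v) (at t)" and M: "range c \<subseteq> M"
    and f: "(f has_derivative F) (at (c t) within M)"
  shows "((\<lambda>s. f (c s)) has_vector_derivative F v) (at t)"
proof -
  have "((\<lambda>s. f (c s)) has_derivative (\<lambda>x. F (x *\<^sub>R v))) (at t)"
    using has_derivative_in_compose[OF c[unfolded has_vector_derivative_def]
        has_derivative_subset[OF f M]] .
  then show ?thesis
    using has_vector_derivative_of_has_derivative by fastforce
qed

lemma smooth_map_on_vector_derivative:
  fixes f :: "real \<Rightarrow> 'a::real_normed_vector"
  assumes "smooth_map_on UNIV f"
  shows "smooth_map_on UNIV (\<lambda>t. vector_derivative f (at t))"
proof (rule smooth_map_onI)
  fix t :: real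
  obtain U F where U: "open U" "t \<in> U" "\<And>n. Ck_on n U F" "\<And>x. x \<in> U \<Longrightarrow> F x = f x"
    using smooth_map_onE[OF assms, of t] by auto
  have "frechet_derivative F (at x) 1 = vector_derivative f (at x)" if "x \<in> U" for x
  proof -
    have "(F has_derivative frechet_derivative F (at x)) (at x)"
      using Ck_on_has_derivative[OF U(1) U(3) that] .
    then have "(f has_derivative frechet_derivative F (at x)) (at x)"
      by (rule has_derivative_transform_within_open[OF _ U(1) that U(4)])
    then have "(f has_vector_derivative frechet_derivative F (at x) 1) (at x)"
      by (rule has_vector_derivative_of_has_derivative)
    then show ?thesis by (simp add: vector_derivative_at)
  qed
  moreover have "Ck_on n U (\<lambda>x. frechet_derivative F (at x) 1)" for n
    using U(3)[of "Suc n"] by simp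
  ultimately show "\<exists>U F. open U \<and> t \<in> U \<and> (\<forall>n. Ck_on n U F)
      \<and> (\<forall>x\<in>U \<inter> UNIV. F x = vector_derivative f (at x))"
    using U(1,2) by (intro exI[of _ U] exI[of _ "\<lambda>x. frechet_derivative F (at x) 1"]) auto
qed

lemma smooth_map_on_cos_sin:
  "smooth_map_on M (\<lambda>t::real. cos (a * t))" "smooth_map_on M (\<lambda>t::real. sin (a * t))"
proof -
  \<comment> \<open>Each function differentiates to a multiple of the other, so the induction has to
    treat both together.\<close>
  have "Ck_on n UNIV (\<lambda>t::real. cos (a * t)) \<and> Ck_on n UNIV (\<lambda>t::real. sin (a * t))" for n
  proof (induction n)
    case 0
    show ?case by (auto intro!: continuous_intros)
  next
    case (Suc n)
    have c: "((\<lambda>t. cos (a * t)) has_derivative (\<lambda>v. v * (- a) * sin (a * t))) (at t)" for t :: real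
      by (auto intro!: derivative_eq_intros)
    have s: "((\<lambda>t. sin (a * t)) has_derivative (\<lambda>v. v * a * cos (a * t))) (at t)" for t :: real
      by (auto intro!: derivative_eq_intros)
    show ?case
      by (intro conjI Ck_on_SucI[OF open_UNIV c] Ck_on_SucI[OF open_UNIV s]
          Ck_on_bounded_linear[OF bounded_linear_mult_right open_UNIV])
         (use Suc in auto)
  qed
  then show "smooth_map_on M (\<lambda>t::real. cos (a * t))" "smooth_map_on M (\<lambda>t::real. sin (a * t))"
    by (auto intro: smooth_map_on_Ck)
qed

section \<open>Quaternions and the tangent spaces\<close>

definition qcnj :: "quat \<Rightarrow> quat" where
  "qcnj x = Quat (qRe x) (- qIm1 x) (- qIm2 x) (- qIm3 x)"

lemma qcnj_sel [simp]:
  "qRe (qcnj x) = qRe x" "qIm1 (qcnj x) = - qIm1 x" "qIm2 (qcnj x) = - qIm2 x" "qIm3 (qcnj x) = - qIm3 x"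
  by (simp_all add: qcnj_def)

lemma qunit_sel [simp]:
  "qRe qi = 0" "qIm1 qi = 1" "qIm2 qi = 0" "qIm3 qi = 0"
  "qRe qj = 0" "qIm1 qj = 0" "qIm2 qj = 1" "qIm3 qj = 0"
  "qRe qk = 0" "qIm1 qk = 0" "qIm2 qk = 0" "qIm3 qk = 1"
  by (simp_all add: qi_def qj_def qk_def)

lemma qcnj_mult: "qcnj (x * y) = qcnj y * qcnj x"
  by (simp add: quat_eq_iff algebra_simps)

lemma qcnj_imaginary: "qRe x = 0 \<Longrightarrow> qcnj x = - x"
  by (simp add: quat_eq_iff)

lemma qRe_commutator: "qRe (x * y) = qRe (y * x)"
  by simp

lemma bounded_linear_qcnj: "bounded_linear qcnj"
  by (rule bounded_linear_intro[of _ 1]) (simp_all add: quat_eq_iff norm_quat_def inner_quat_def)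

lemma bounded_linear_qRe: "bounded_linear qRe"
  by (rule bounded_linear_intro[of _ 1]) (simp_all add: norm_quat_def inner_quat_def real_le_rsqrt power2_eq_square)

lemma smooth_map_on_qcnj: "smooth_map_on M f \<Longrightarrow> smooth_map_on M (\<lambda>x. qcnj (f x))"
  by (rule smooth_map_on_bounded_linear[OF bounded_linear_qcnj])

lemma
  assumes "norm p = 1"
  shows qcnj_mult_unit: "qcnj p * p = 1" and unit_mult_qcnj: "p * qcnj p = 1"
    and inverse_unit_quat: "inverse p = qcnj p"
proof -
  have *: "p \<bullet> p = 1" using assms by (simp add: norm_eq_1)
  then show "qcnj p * p = 1" "p * qcnj p = 1"
    by (auto simp: quat_eq_iff inner_quat_def algebra_simps)
  show "inverse p = qcnj p" using * by (simp add: inverse_quat_def qcnj_def)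
qed

lemma qcnj_mult_unit_left: "norm p = 1 \<Longrightarrow> qcnj p * (p * x) = x"
  by (simp add: mult.assoc[symmetric] qcnj_mult_unit)

lemma unit_mult_qcnj_left: "norm p = 1 \<Longrightarrow> p * (qcnj p * x) = x"
  by (simp add: mult.assoc[symmetric] unit_mult_qcnj)

lemma norm_qcnj [simp]: "norm (qcnj x) = norm x"
  by (simp add: norm_quat_def inner_quat_def)

lemma tangent_S3_iff:
  assumes "norm p = 1"
  shows "U \<in> tangent_S3 p \<longleftrightarrow> qRe (qcnj p * U) = 0"
proof
  assume "U \<in> tangent_S3 p"
  then show "qRe (qcnj p * U) = 0"
    using assms by (auto simp: tangent_S3_def ImH_def qcnj_mult_unit_left simp del: quat_ring_sel)
next
  assume "qRe (qcnj p * U) = 0"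
  then show "U \<in> tangent_S3 p"
    unfolding tangent_S3_def ImH_def
    by (intro image_eqI[of _ _ "qcnj p * U"]) (use assms in \<open>simp_all add: unit_mult_qcnj_left\<close>)
qed

lemma qRe_qcnj_mult: "qRe (qcnj p * U) = p \<bullet> U"
  by (simp add: inner_quat_def)

section \<open>Left-invariant fields and derivatives along the product of spheres\<close>

definition left_translate :: "quat \<times> quat \<Rightarrow> quat \<times> quat \<Rightarrow> quat \<times> quat" where
  "left_translate \<xi> P = (fst P * fst \<xi>, snd P * snd \<xi>)"

definition ImH2 :: "(quat \<times> quat) set" where
  "ImH2 = ImH \<times> ImH"

lemma tangent_S3S3_eq: "tangent_S3S3 P = (\<lambda>\<xi>. left_translate \<xi> P) ` ImH2"
  by (cases P) (auto simp: tangent_S3S3_def tangent_S3_def left_translate_def ImH2_def image_iff)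

lemma left_translate_tangent: "\<xi> \<in> ImH2 \<Longrightarrow> left_translate \<xi> P \<in> tangent_S3S3 P"
  by (simp add: tangent_S3S3_eq)

lemma bounded_linear_left_translate: "bounded_linear (left_translate \<xi>)"
  unfolding left_translate_def
  by (intro bounded_linear_Pair bounded_linear_mult_const bounded_linear_fst bounded_linear_snd)

lemma vector_field_left_translate:
  "\<xi> \<in> ImH2 \<Longrightarrow> vector_field_on S3S3 tangent_S3S3 (left_translate \<xi>)"
  by (simp add: vector_field_on_def left_translate_tangent
      smooth_map_on_linear_self[OF bounded_linear_left_translate])

text \<open>Supplies test curves in the sphere with prescribed velocity. Since
  \<open>sgn 0 = 0\<close>, the same formula gives the constant curve when
  \<open>U = 0\<close>.\<close>

lemma great_circle:
  assumes "norm p = 1" "U \<in> tangent_S3 p"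
  shows "\<exists>c. range c \<subseteq> S3 \<and> c 0 = p \<and> (c has_vector_derivative U) (at (0::real))"
proof -
  let ?c = "\<lambda>s. cos (norm U * s) *\<^sub>R p + sin (norm U * s) *\<^sub>R sgn U"
  have pp: "p \<bullet> p = 1" and pU: "p \<bullet> U = 0"
    using assms tangent_S3_iff[OF assms(1)] unfolding qRe_qcnj_mult by (auto simp: norm_eq_1)
  have "?c s \<bullet> ?c s = 1" for s
  proof (cases "U = 0")
    case False
    then have "sgn U \<bullet> sgn U = 1"
      unfolding norm_eq_1[symmetric] by (simp add: norm_sgn)
    moreover have "p \<bullet> sgn U = 0" "sgn U \<bullet> p = 0"
      using pU by (simp_all add: sgn_div_norm inner_commute)
    ultimately have "?c s \<bullet> ?c s = cos (norm U * s) ^ 2 + sin (norm U * s) ^ 2"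
      using pp by (simp add: inner_add_left inner_add_right power2_eq_square)
    then show ?thesis by simp
  qed (use pp in simp)
  then have "range ?c \<subseteq> S3" by (auto simp: S3_def norm_eq_1)
  moreover have "(?c has_vector_derivative norm U *\<^sub>R sgn U) (at 0)"
    by (auto intro!: derivative_eq_intros)
  then have "(?c has_vector_derivative U) (at 0)"
    by (cases "U = 0") (simp_all add: sgn_div_norm)
  ultimately show ?thesis by (intro exI[of _ ?c]) auto
qed

text \<open>Along a curve in \<open>S3S3\<close> with velocity \<open>v\<close>, the chain rule
  expresses the derivative of \<open>f\<close> by any derivative within \<open>S3S3\<close>, and
  vector derivatives of curves are unique. Hence all derivatives within \<open>S3S3\<close> agree on
  tangent vectors, including the one chosen by \<open>frechet_derivative\<close>.\<close>

lemma deriv_along_eq: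
  assumes P: "P \<in> S3S3" and v: "v \<in> tangent_S3S3 P" and F: "(f has_derivative F) (at P within S3S3)"
  shows "deriv_along S3S3 f P v = F v"
proof -
  obtain p q U V where eq: "P = (p, q)" "v = (U, V)" by (metis surj_pair)
  then have *: "norm p = 1" "norm q = 1" "U \<in> tangent_S3 p" "V \<in> tangent_S3 q"
    using P v by (auto simp: S3S3_def S3_def tangent_S3S3_def)
  obtain c d where c: "range c \<subseteq> S3" "c 0 = p" "(c has_vector_derivative U) (at (0::real))"
    and d: "range d \<subseteq> S3" "d 0 = q" "(d has_vector_derivative V) (at (0::real))"
    using great_circle * by meson
  let ?e = "\<lambda>s. (c s, d s)"
  have e: "(?e has_vector_derivative v) (at 0)" "range ?e \<subseteq> S3S3"
    using c d by (auto simp: eq S3S3_def has_vector_derivative_Pair)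
  have "((\<lambda>s. f (?e s)) has_vector_derivative G v) (at 0)"
    if "(f has_derivative G) (at P within S3S3)" for G
    using has_vector_derivative_compose_within[OF e, of f G] that c(2) d(2) eq by simp
  moreover have "(f has_derivative frechet_derivative f (at P within S3S3)) (at P within S3S3)"
    using F by (meson differentiableI frechet_derivative_works)
  ultimately show ?thesis
    unfolding deriv_along_def using F vector_derivative_unique_at by blast
qed

lemma smooth_deriv_along:
  assumes "smooth_map_on S3S3 f" "P \<in> S3S3"
  shows "(f has_derivative deriv_along S3S3 f P) (at P within S3S3)"
  using smooth_map_on_has_derivative[OF assms] by (simp add: deriv_along_def[abs_def])

lemma quat_pair_basis:
  obtains B :: "(quat \<times> quat) set" where "finite B" "\<And>w. w = (\<Sum>b\<in>B. (w \<bullet> b) *\<^sub>R b)"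
proof
  let ?B = "{(1, 0), (qi, 0), (qj, 0), (qk, 0), (0, 1), (0, qi), (0, qj), (0, qk)} :: (quat \<times> quat) set"
  show "finite ?B" by simp
  show "w = (\<Sum>b\<in>?B. (w \<bullet> b) *\<^sub>R b)" for w :: "quat \<times> quat"
    by (cases w) (simp add: quat_eq_iff inner_quat_def)
qed

lemma ImH2_basis:
  obtains B :: "(quat \<times> quat) set" where "finite B" "B \<subseteq> ImH2"
    "\<And>w. w \<in> ImH2 \<Longrightarrow> w = (\<Sum>b\<in>B. (w \<bullet> b) *\<^sub>R b)"
proof
  let ?B = "{(qi, 0), (qj, 0), (qk, 0), (0, qi), (0, qj), (0, qk)} :: (quat \<times> quat) set"
  show "finite ?B" "?B \<subseteq> ImH2" by (simp_all add: ImH2_def ImH_def)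
  show "w = (\<Sum>b\<in>?B. (w \<bullet> b) *\<^sub>R b)" if "w \<in> ImH2" for w :: "quat \<times> quat"
    using that by (cases w) (simp add: quat_eq_iff inner_quat_def ImH2_def ImH_def)
qed

text \<open>The candidate extension is the derivative of a local extension of \<open>Y\<close>
  applied to a local extension of \<open>X\<close>. On \<open>S3S3\<close> it gives the right value
  because \<open>X\<close> is tangent there.\<close>

lemma smooth_map_on_deriv_along:
  assumes Y: "smooth_map_on S3S3 Y" and X: "vector_field_on S3S3 tangent_S3S3 X"
  shows "smooth_map_on S3S3 (\<lambda>P. deriv_along S3S3 Y P (X P))"
proof (rule smooth_map_onI)
  fix P :: "quat \<times> quat" assume "P \<in> S3S3"
  obtain U F where F: "open U" "P \<in> U" "\<And>n. Ck_on n U F" "\<And>x. x \<in> U \<Longrightarrow> x \<in> S3S3 \<Longrightarrow> F x = Y x"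
    using smooth_map_onE[OF Y \<open>P \<in> S3S3\<close>] by blast
  obtain V G where G: "open V" "P \<in> V" "\<And>n. Ck_on n V G" "\<And>x. x \<in> V \<Longrightarrow> x \<in> S3S3 \<Longrightarrow> G x = X x"
    using smooth_map_onE[of S3S3 X] X \<open>P \<in> S3S3\<close> unfolding vector_field_on_def by blast
  have W: "open (U \<inter> V)" "U \<inter> V \<subseteq> U" "U \<inter> V \<subseteq> V" using F(1) G(1) by auto
  obtain B :: "(quat \<times> quat) set" where B: "finite B" "\<And>w. w = (\<Sum>b\<in>B. (w \<bullet> b) *\<^sub>R b)"
    using quat_pair_basis by blast
  have "Ck_on n (U \<inter> V) (\<lambda>x. frechet_derivative F (at x) (G x))" for n
    by (rule Ck_on_frechet_derivative_apply[OF W(1) Ck_on_open_subset[OF F(1) W(1,2) F(3)]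
          Ck_on_open_subset[OF G(1) W(1,3) G(3)] B])
  moreover have "frechet_derivative F (at x) (G x) = deriv_along S3S3 Y x (X x)"
    if "x \<in> U \<inter> V" "x \<in> S3S3" for x
  proof -
    have "X x \<in> tangent_S3S3 x" using X that by (simp add: vector_field_on_def)
    then show ?thesis
      using that G(4) deriv_along_eq[OF _ _ Ck_on_extension_has_derivative[OF F(1) F(3)]] F(4) by simp
  qed
  ultimately show "\<exists>U F. open U \<and> P \<in> U \<and> (\<forall>n. Ck_on n U F)
      \<and> (\<forall>x\<in>U \<inter> S3S3. F x = deriv_along S3S3 Y x (X x))"
    using F(2) G(2) W(1)
    by (intro exI[of _ "U \<inter> V"] exI[of _ "\<lambda>x. frechet_derivative F (at x) (G x)"]) auto
qed

section \<open>The Levi-Civita connection\<close>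

text \<open>Inverse of \<open>left_translate\<close> over points of \<open>S3S3\<close>. Conjugation
  replaces inversion, with which it agrees on unit quaternions, so that the map is real bilinear on
  the whole ambient space, hence smooth with an immediate product rule.\<close>

definition trivialize :: "quat \<times> quat \<Rightarrow> quat \<times> quat \<Rightarrow> quat \<times> quat" where
  "trivialize P v = (qcnj (fst P) * fst v, qcnj (snd P) * snd v)"

definition nk_inner :: "quat \<times> quat \<Rightarrow> quat \<times> quat \<Rightarrow> real" where
  "nk_inner \<xi> \<eta> = 4/3 * (fst \<xi> \<bullet> fst \<eta> + snd \<xi> \<bullet> snd \<eta>) - 2/3 * (fst \<xi> \<bullet> snd \<eta> + fst \<eta> \<bullet> snd \<xi>)"

definition cross_term :: "quat \<times> quat \<Rightarrow> quat \<times> quat \<Rightarrow> quat" where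
  "cross_term \<xi> \<eta> = (fst \<xi> * snd \<eta> - snd \<eta> * fst \<xi>) + (fst \<eta> * snd \<xi> - snd \<xi> * fst \<eta>)"

definition left_bracket :: "quat \<times> quat \<Rightarrow> quat \<times> quat \<Rightarrow> quat \<times> quat" where
  "left_bracket \<xi> \<eta> = (fst \<xi> * fst \<eta> - fst \<eta> * fst \<xi>, snd \<xi> * snd \<eta> - snd \<eta> * snd \<xi>)"

text \<open>The Koszul formula for left-invariant fields. Half the bracket is the antisymmetric part
  forced by vanishing torsion; the symmetric part is forced by the metric. With C the
  \<open>cross_term\<close>, bi-invariance of the Euclidean product leaves only the mixed part of
  \<open>nk_inner\<close>, so twice the symmetric part is represented by -2/3 (C, -C). Pairs (C, -C)
  are eigenvectors of the metric with eigenvalue 4/3 + 2/3 = 2, whence the factor 1/6.\<close>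

definition left_connection :: "quat \<times> quat \<Rightarrow> quat \<times> quat \<Rightarrow> quat \<times> quat" where
  "left_connection \<xi> \<eta> =
     (1/2) *\<^sub>R left_bracket \<xi> \<eta> + (1/6) *\<^sub>R (- cross_term \<xi> \<eta>, cross_term \<xi> \<eta>)"

text \<open>The derivative of \<open>trivialize P w\<close> in \<open>P\<close> contributes \<open>- \<xi> \<eta>\<close> to the covariant derivative,
  which turns the halved commutators of \<^const>\<open>left_connection\<close> into halved anticommutators.\<close>

definition christoffel :: "quat \<times> quat \<Rightarrow> quat \<times> quat \<Rightarrow> quat \<times> quat \<Rightarrow> quat \<times> quat" where
  "christoffel P v w = left_translate
     (- (1/2) *\<^sub>R (fst (trivialize P v) * fst (trivialize P w) + fst (trivialize P w) * fst (trivialize P v))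
        - (1/6) *\<^sub>R cross_term (trivialize P v) (trivialize P w),
      - (1/2) *\<^sub>R (snd (trivialize P v) * snd (trivialize P w) + snd (trivialize P w) * snd (trivialize P v))
        + (1/6) *\<^sub>R cross_term (trivialize P v) (trivialize P w)) P"

definition nk_nabla ::
    "quat \<times> quat \<Rightarrow> quat \<times> quat \<Rightarrow> (quat \<times> quat \<Rightarrow> quat \<times> quat) \<Rightarrow> quat \<times> quat" where
  "nk_nabla P v Y = deriv_along S3S3 Y P v + christoffel P v (Y P)"

lemma S3S3_norm: "P \<in> S3S3 \<Longrightarrow> norm (fst P) = 1" "P \<in> S3S3 \<Longrightarrow> norm (snd P) = 1"
  by (auto simp: S3S3_def S3_def)

lemma trivialize_left_translate: "P \<in> S3S3 \<Longrightarrow> trivialize P (left_translate \<xi> P) = \<xi>"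
  by (simp add: trivialize_def left_translate_def qcnj_mult_unit_left S3S3_norm)

lemma left_translate_trivialize: "P \<in> S3S3 \<Longrightarrow> left_translate (trivialize P v) P = v"
  by (simp add: trivialize_def left_translate_def unit_mult_qcnj_left S3S3_norm)

lemma trivialize_tangent:
  assumes "P \<in> S3S3" "v \<in> tangent_S3S3 P"
  shows "trivialize P v \<in> ImH2"
  using assms by (auto simp: tangent_S3S3_eq trivialize_left_translate)

lemma nk_metric_eq:
  assumes "P \<in> S3S3"
  shows "nk_metric P Z Z' = nk_inner (trivialize P Z) (trivialize P Z')"
proof -
  obtain p q U V U' V' where eq: "P = (p, q)" "Z = (U, V)" "Z' = (U', V')" by (metis surj_pair)
  have n: "norm p = 1" "norm q = 1" using assms eq S3S3_norm by fastforce+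
  then have "norm (qcnj p) = 1" "norm (qcnj q) = 1" by simp_all
  then show ?thesis
    using nk_metric_explicit[of p q U V U' V'] assms n unfolding eq
    by (simp add: nk_inner_def trivialize_def inverse_unit_quat inner_unit_mult_left)
qed

lemma has_derivative_trivialize:
  assumes "(f has_derivative f') (at x within S)" "(g has_derivative g') (at x within S)"
  shows "((\<lambda>x. trivialize (f x) (g x)) has_derivative
    (\<lambda>v. trivialize (f x) (g' v) + trivialize (f' v) (g x))) (at x within S)"
  unfolding trivialize_def
  by (auto intro!: derivative_eq_intros assms bounded_linear.has_derivative[OF bounded_linear_qcnj])

lemma smooth_christoffel:
  assumes "smooth_map_on M f" "smooth_map_on M v" "smooth_map_on M w"
  shows "smooth_map_on M (\<lambda>x. christoffel (f x) (v x) (w x))"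
  unfolding christoffel_def left_translate_def trivialize_def cross_term_def fst_conv snd_conv
  by (intro smooth_intros smooth_map_on_qcnj assms)

lemma christoffel_sym: "christoffel P v w = christoffel P w v"
  by (simp add: christoffel_def cross_term_def algebra_simps)

lemma christoffel_linear:
  "christoffel P (v + v') w = christoffel P v w + christoffel P v' w"
  "christoffel P (r *\<^sub>R v) w = r *\<^sub>R christoffel P v w"
  "christoffel P v (w + w') = christoffel P v w + christoffel P v w'"
  "christoffel P v (r *\<^sub>R w) = r *\<^sub>R christoffel P v w"
  by (simp_all add: christoffel_def cross_term_def trivialize_def left_translate_def algebra_simps
      scaleR_right_diff_distrib scaleR_right_distrib)

lemma left_connection_ImH2: "\<xi> \<in> ImH2 \<Longrightarrow> \<eta> \<in> ImH2 \<Longrightarrow> left_connection \<xi> \<eta> \<in> ImH2"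
  by (auto simp: ImH2_def ImH_def left_connection_def left_bracket_def cross_term_def)

lemma ImH2_add: "\<xi> \<in> ImH2 \<Longrightarrow> \<eta> \<in> ImH2 \<Longrightarrow> \<xi> + \<eta> \<in> ImH2"
  by (auto simp: ImH2_def ImH_def)

text \<open>The computation shared by \<open>nk_nabla\<close> and \<open>nk_covariant\<close>, with
  \<open>a\<close> an arbitrary ambient derivative. Since \<open>trivialize\<close> is linear in its
  base point, \<open>trivialize v w\<close> is its derivative in the direction \<open>v\<close>; for
  v = P \<xi> with \<xi> imaginary it equals - \<xi> \<eta>, because conjugation negates
  \<xi>.\<close>

lemma add_christoffel:
  assumes P: "P \<in> S3S3" and v: "v \<in> tangent_S3S3 P"
  shows "a + christoffel P v w = left_translate
    (trivialize v w + trivialize P a + left_connection (trivialize P v) (trivialize P w)) P"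
proof -
  obtain \<xi> where \<xi>: "\<xi> \<in> ImH2" "v = left_translate \<xi> P" using v by (auto simp: tangent_S3S3_eq)
  define \<eta> b where "\<eta> = trivialize P w" and "b = trivialize P a"
  have w: "w = left_translate \<eta> P" "a = left_translate b P"
    using P by (simp_all add: \<eta>_def b_def left_translate_trivialize)
  have "trivialize v w = (- (fst \<xi> * fst \<eta>), - (snd \<xi> * snd \<eta>))"
    unfolding \<xi> w using \<xi>(1) P
    by (auto simp: trivialize_def left_translate_def qcnj_mult mult.assoc qcnj_mult_unit_left
        S3S3_norm qcnj_imaginary ImH2_def ImH_def simp del: quat_ring_sel)
  then show ?thesis
    unfolding christoffel_def
    unfolding w \<xi>(2) trivialize_left_translate[OF P]
    by (simp add: left_translate_def left_connection_def left_bracket_def quat_eq_iff algebra_simps)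
qed

lemma nk_inner_add_left: "nk_inner (\<xi> + \<eta>) \<zeta> = nk_inner \<xi> \<zeta> + nk_inner \<eta> \<zeta>"
  and nk_inner_add_right: "nk_inner \<zeta> (\<xi> + \<eta>) = nk_inner \<zeta> \<xi> + nk_inner \<zeta> \<eta>"
  and nk_inner_diff_left: "nk_inner (\<xi> - \<eta>) \<zeta> = nk_inner \<xi> \<zeta> - nk_inner \<eta> \<zeta>"
  and nk_inner_commute: "nk_inner \<xi> \<eta> = nk_inner \<eta> \<xi>"
  by (simp_all add: nk_inner_def inner_add_left inner_add_right inner_diff_left inner_diff_right
      inner_commute algebra_simps)

lemma has_derivative_nk_inner:
  assumes "(f has_derivative f') (at x within S)" "(g has_derivative g') (at x within S)"
  shows "((\<lambda>x. nk_inner (f x) (g x)) has_derivative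
    (\<lambda>v. nk_inner (f' v) (g x) + nk_inner (f x) (g' v))) (at x within S)"
  unfolding nk_inner_def
  by (auto intro!: derivative_eq_intros assms simp: algebra_simps add_divide_distrib)

text \<open>Metric compatibility on the Lie algebra: left-invariant fields have constant inner
  products, so the connection must act by skew maps.\<close>

lemma nk_inner_left_connection:
  assumes "\<xi> \<in> ImH2" "\<eta> \<in> ImH2" "\<zeta> \<in> ImH2"
  shows "nk_inner (left_connection \<xi> \<eta>) \<zeta> + nk_inner \<eta> (left_connection \<xi> \<zeta>) = 0"
  using assms
  by (auto simp: ImH2_def ImH_def nk_inner_def left_connection_def left_bracket_def cross_term_def
      inner_quat_def algebra_simps)

lemma has_derivative_trivialize_field:
  assumes Y: "vector_field_on S3S3 tangent_S3S3 Y" and P: "P \<in> S3S3"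
  shows "((\<lambda>x. trivialize x (Y x)) has_derivative
     (\<lambda>v. trivialize P (deriv_along S3S3 Y P v) + trivialize v (Y P))) (at P within S3S3)"
  using Y P has_derivative_trivialize[OF has_derivative_ident smooth_deriv_along]
  by (auto simp: vector_field_on_def)

lemma vector_field_trivialize:
  assumes "vector_field_on S3S3 tangent_S3S3 Y" "P \<in> S3S3"
  shows "trivialize P (Y P) \<in> ImH2"
  using assms by (simp add: vector_field_on_def trivialize_tangent)

text \<open>The two summands are the product rule for the trivialized field and need not be
  imaginary separately. The field has values in \<open>ImH2\<close>, so the real parts of its
  components vanish identically on \<open>S3S3\<close> and have zero derivative in tangent
  directions.\<close>

lemma deriv_trivialize_field_ImH2:
  assumes Y: "vector_field_on S3S3 tangent_S3S3 Y" and P: "P \<in> S3S3" and v: "v \<in> tangent_S3S3 P"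
  shows "trivialize v (Y P) + trivialize P (deriv_along S3S3 Y P v) \<in> ImH2"
proof -
  define y' where "y' v = trivialize P (deriv_along S3S3 Y P v) + trivialize v (Y P)" for v
  have zero: "h (y' v) = 0" if h: "bounded_linear h" and "\<And>\<xi>. \<xi> \<in> ImH2 \<Longrightarrow> h \<xi> = 0"
    for h :: "quat \<times> quat \<Rightarrow> real"
  proof -
    have "((\<lambda>x. h (trivialize x (Y x))) has_derivative (\<lambda>v. h (y' v))) (at P within S3S3)"
      using bounded_linear.has_derivative[OF h has_derivative_trivialize_field[OF Y P]]
      by (simp add: y'_def)
    moreover have "((\<lambda>x. h (trivialize x (Y x))) has_derivative (\<lambda>v. 0)) (at P within S3S3)"
      by (rule has_derivative_transform[OF P _ has_derivative_const[of 0]])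
         (simp add: that(2) vector_field_trivialize[OF Y])
    ultimately show ?thesis
      using deriv_along_eq[OF P v] by metis
  qed
  have "qRe (fst (y' v)) = 0" "qRe (snd (y' v)) = 0"
    by (rule zero; auto intro!: bounded_linear_compose[OF bounded_linear_qRe] bounded_linear_fst bounded_linear_snd
        simp: ImH2_def ImH_def)+
  then show ?thesis
    by (simp add: y'_def ImH2_def ImH_def mem_Times_iff add.commute)
qed

lemma nk_nabla_eq:
  assumes "P \<in> S3S3" "v \<in> tangent_S3S3 P"
  shows "nk_nabla P v Y = left_translate
    (trivialize v (Y P) + trivialize P (deriv_along S3S3 Y P v)
      + left_connection (trivialize P v) (trivialize P (Y P))) P"
  unfolding nk_nabla_def using add_christoffel[OF assms] .

text \<open>Smoothness is visible in the ambient formula defining \<open>nk_nabla\<close>, tangency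
  only in its trivialized form \<open>nk_nabla_eq\<close>.\<close>

lemma vector_field_nk_nabla:
  assumes X: "vector_field_on S3S3 tangent_S3S3 X" and Y: "vector_field_on S3S3 tangent_S3S3 Y"
  shows "vector_field_on S3S3 tangent_S3S3 (\<lambda>P. nk_nabla P (X P) Y)"
  unfolding vector_field_on_def
proof
  show "smooth_map_on S3S3 (\<lambda>P. nk_nabla P (X P) Y)"
    unfolding nk_nabla_def using X Y
    by (intro smooth_map_on_add smooth_map_on_deriv_along smooth_christoffel
        smooth_map_on_linear_self[OF bounded_linear_ident])
       (auto simp: vector_field_on_def)
  show "\<forall>P\<in>S3S3. nk_nabla P (X P) Y \<in> tangent_S3S3 P"
  proof
    fix P :: "quat \<times> quat" assume P: "P \<in> S3S3"
    then have v: "X P \<in> tangent_S3S3 P" using X by (simp add: vector_field_on_def)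
    show "nk_nabla P (X P) Y \<in> tangent_S3S3 P"
      unfolding nk_nabla_eq[OF P v]
      by (intro left_translate_tangent ImH2_add left_connection_ImH2 trivialize_tangent
          deriv_trivialize_field_ImH2 P v Y vector_field_trivialize)
  qed
qed

lemma deriv_along_linear:
  assumes "smooth_map_on S3S3 f" "P \<in> S3S3"
  shows "linear (deriv_along S3S3 f P)"
  using has_derivative_linear[OF smooth_deriv_along[OF assms]] .

lemma affine_connection_nk_nabla: "affine_connection S3S3 tangent_S3S3 nk_nabla"
  unfolding affine_connection_def
proof (intro conjI allI impI)
  fix Y :: "quat \<times> quat \<Rightarrow> quat \<times> quat" and P v w :: "quat \<times> quat" and r s :: real
  assume Y: "vector_field_on S3S3 tangent_S3S3 Y" and P: "P \<in> S3S3"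
  have "linear (deriv_along S3S3 Y P)"
    using Y P by (simp add: vector_field_on_def deriv_along_linear)
  then show "nk_nabla P (r *\<^sub>R v + s *\<^sub>R w) Y = r *\<^sub>R nk_nabla P v Y + s *\<^sub>R nk_nabla P w Y"
    by (simp add: nk_nabla_def christoffel_linear linear_add linear_scale algebra_simps)
next
  fix Y Z :: "quat \<times> quat \<Rightarrow> quat \<times> quat" and P v :: "quat \<times> quat"
  assume *: "vector_field_on S3S3 tangent_S3S3 Y" "vector_field_on S3S3 tangent_S3S3 Z"
    "P \<in> S3S3" "v \<in> tangent_S3S3 P"
  have "deriv_along S3S3 (\<lambda>x. Y x + Z x) P v = deriv_along S3S3 Y P v + deriv_along S3S3 Z P v"
    by (rule deriv_along_eq[OF *(3,4) has_derivative_add[OF smooth_deriv_along smooth_deriv_along]])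
       (use * in \<open>auto simp: vector_field_on_def\<close>)
  then show "nk_nabla P v (\<lambda>x. Y x + Z x) = nk_nabla P v Y + nk_nabla P v Z"
    by (simp add: nk_nabla_def christoffel_linear)
next
  fix f :: "quat \<times> quat \<Rightarrow> real" and Y :: "quat \<times> quat \<Rightarrow> quat \<times> quat" and P v :: "quat \<times> quat"
  assume *: "smooth_map_on S3S3 f" "vector_field_on S3S3 tangent_S3S3 Y" "P \<in> S3S3" "v \<in> tangent_S3S3 P"
  have "deriv_along S3S3 (\<lambda>x. f x *\<^sub>R Y x) P v
      = f P *\<^sub>R deriv_along S3S3 Y P v + deriv_along S3S3 f P v *\<^sub>R Y P"
    by (rule deriv_along_eq[OF *(3,4) has_derivative_scaleR[OF smooth_deriv_along smooth_deriv_along]])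
       (use * in \<open>auto simp: vector_field_on_def\<close>)
  then show "nk_nabla P v (\<lambda>x. f x *\<^sub>R Y x) = deriv_along S3S3 f P v *\<^sub>R Y P + f P *\<^sub>R nk_nabla P v Y"
    by (simp add: nk_nabla_def christoffel_linear scaleR_right_distrib)
next
  fix Y Z :: "quat \<times> quat \<Rightarrow> quat \<times> quat" and P v :: "quat \<times> quat"
  assume *: "vector_field_on S3S3 tangent_S3S3 Y" "vector_field_on S3S3 tangent_S3S3 Z"
    "\<forall>x\<in>S3S3. Y x = Z x" "P \<in> S3S3" "v \<in> tangent_S3S3 P"
  have "smooth_map_on S3S3 Z" using *(2) by (simp add: vector_field_on_def)
  \<comment> \<open>The fields may differ off \<open>S3S3\<close>, and the chosen derivatives of
    \<open>Y\<close> and \<open>Z\<close> may differ in normal directions; the derivative of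
    \<open>Z\<close> is still a derivative of \<open>Y\<close> within \<open>S3S3\<close>, and
    \<open>v\<close> is tangent.\<close>
  then have "(Y has_derivative deriv_along S3S3 Z P) (at P within S3S3)"
    using has_derivative_transform[OF *(4) _ smooth_deriv_along[OF _ *(4)]] *(3) by blast
  then show "nk_nabla P v Y = nk_nabla P v Z"
    using deriv_along_eq[OF *(4,5)] *(3,4) by (simp add: nk_nabla_def)
qed (rule vector_field_nk_nabla)

lemma levi_civita_nk_nabla: "levi_civita_connection S3S3 tangent_S3S3 nk_metric nk_nabla"
  unfolding levi_civita_connection_def
proof (intro conjI allI impI)
  show "affine_connection S3S3 tangent_S3S3 nk_nabla"
    by (rule affine_connection_nk_nabla)
next
  fix X Y :: "quat \<times> quat \<Rightarrow> quat \<times> quat" and P :: "quat \<times> quat"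
  show "nk_nabla P (X P) Y - nk_nabla P (Y P) X = lie_bracket S3S3 X Y P"
    by (simp add: nk_nabla_def lie_bracket_def christoffel_sym)
next
  fix Y Z :: "quat \<times> quat \<Rightarrow> quat \<times> quat" and P v :: "quat \<times> quat"
  assume *: "vector_field_on S3S3 tangent_S3S3 Y" "vector_field_on S3S3 tangent_S3S3 Z"
    "P \<in> S3S3" "v \<in> tangent_S3S3 P"
  let ?y = "\<lambda>x. trivialize x (Y x)" and ?z = "\<lambda>x. trivialize x (Z x)"
  let ?y' = "\<lambda>v. trivialize P (deriv_along S3S3 Y P v) + trivialize v (Y P)"
  let ?z' = "\<lambda>v. trivialize P (deriv_along S3S3 Z P v) + trivialize v (Z P)"
  have "((\<lambda>x. nk_inner (?y x) (?z x)) has_derivative (\<lambda>v. nk_inner (?y' v) (?z P) + nk_inner (?y P) (?z' v)))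
      (at P within S3S3)"
    by (rule has_derivative_nk_inner[OF has_derivative_trivialize_field[OF *(1,3)]
          has_derivative_trivialize_field[OF *(2,3)]])
  then have "((\<lambda>x. nk_metric x (Y x) (Z x)) has_derivative
      (\<lambda>v. nk_inner (?y' v) (?z P) + nk_inner (?y P) (?z' v))) (at P within S3S3)"
    by (rule has_derivative_transform[OF *(3), rotated]) (simp add: nk_metric_eq)
  then have "deriv_along S3S3 (\<lambda>x. nk_metric x (Y x) (Z x)) P v
      = nk_inner (?y' v) (?z P) + nk_inner (?y P) (?z' v)"
    using deriv_along_eq[OF *(3,4)] by blast
  \<comment> \<open>In the trivialization the metric is the constant form \<open>nk_inner\<close>;
    the extra \<open>left_connection\<close> terms on the right cancel by skewness.\<close>
  also have "\<dots> = nk_metric P (nk_nabla P v Y) (Z P) + nk_metric P (Y P) (nk_nabla P v Z)"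
    unfolding nk_metric_eq[OF *(3)] nk_nabla_eq[OF *(3,4)] trivialize_left_translate[OF *(3)]
    using nk_inner_left_connection[OF trivialize_tangent[OF *(3,4)]
        vector_field_trivialize[OF *(1,3)] vector_field_trivialize[OF *(2,3)]]
    by (simp add: nk_inner_add_left nk_inner_add_right)
  finally show "deriv_along S3S3 (\<lambda>x. nk_metric x (Y x) (Z x)) P v
      = nk_metric P (nk_nabla P v Y) (Z P) + nk_metric P (Y P) (nk_nabla P v Z)" .
qed

section \<open>Geodesics as solutions of the Euler--Arnold equation\<close>

text \<open>The trivialized velocity \<xi> is carried as a separate function, so that the
  second-order geodesic equation becomes a first-order system whose second line does not involve
  \<gamma>.\<close>

definition euler_arnold :: "(real \<Rightarrow> quat \<times> quat) \<Rightarrow> (real \<Rightarrow> quat \<times> quat) \<Rightarrow> bool" where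
  "euler_arnold \<gamma> \<xi> \<longleftrightarrow> (\<forall>t. \<gamma> t \<in> S3S3 \<and> \<xi> t \<in> ImH2 \<and>
     (\<gamma> has_vector_derivative left_translate (\<xi> t) (\<gamma> t)) (at t) \<and>
     (\<xi> has_vector_derivative - left_connection (\<xi> t) (\<xi> t)) (at t))"

lemma left_translate_linear:
  "left_translate (\<xi> + \<eta>) P = left_translate \<xi> P + left_translate \<eta> P"
  "left_translate (r *\<^sub>R \<xi>) P = r *\<^sub>R left_translate \<xi> P"
  by (simp_all add: left_translate_def algebra_simps)

lemma linear_left_translate: "linear (\<lambda>\<xi>. left_translate \<xi> P)"
  by (rule linearI) (simp_all add: left_translate_linear)

lemma linear_left_connection: "linear (left_connection \<xi>)"
  by (rule linearI)
     (simp_all add: left_connection_def left_bracket_def cross_term_def quat_eq_iff algebra_simps)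

lemma left_connection_torsion: "left_connection \<xi> \<eta> - left_connection \<eta> \<xi> = left_bracket \<xi> \<eta>"
  by (simp add: left_connection_def left_bracket_def cross_term_def quat_eq_iff algebra_simps)

lemma nk_inner_definite:
  assumes "nk_inner w w = 0"
  shows "w = 0"
proof -
  have "nk_inner w w = 2/3 * (fst w \<bullet> fst w + snd w \<bullet> snd w + (fst w - snd w) \<bullet> (fst w - snd w))"
    by (simp add: nk_inner_def inner_diff_left inner_diff_right inner_commute algebra_simps)
  then have "fst w \<bullet> fst w + snd w \<bullet> snd w + (fst w - snd w) \<bullet> (fst w - snd w) = 0"
    using assms by simp
  then have "fst w \<bullet> fst w = 0" "snd w \<bullet> snd w = 0"
    using inner_ge_zero[of "fst w"] inner_ge_zero[of "snd w"] inner_ge_zero[of "fst w - snd w"] by linarith+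
  then show ?thesis by (simp add: prod_eq_iff)
qed

section \<open>Uniqueness of the Levi-Civita connection on left-invariant fields\<close>

lemma
  assumes lc: "levi_civita_connection M T g nabla"
    and X: "vector_field_on M T X" and Y: "vector_field_on M T Y"
  shows levi_civita_vector_field: "vector_field_on M T (\<lambda>p. nabla p (X p) Y)"
    and levi_civita_torsion: "p \<in> M \<Longrightarrow> nabla p (X p) Y - nabla p (Y p) X = lie_bracket M X Y p"
    and levi_civita_metric: "p \<in> M \<Longrightarrow> v \<in> T p \<Longrightarrow>
      deriv_along M (\<lambda>x. g x (X x) (Y x)) p v = g p (nabla p v X) (Y p) + g p (X p) (nabla p v Y)"
  subgoal
    by (rule lc[unfolded levi_civita_connection_def affine_connection_def, THEN conjunct1, THEN conjunct1,
          rule_format, OF X Y])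
  subgoal
    by (rule lc[unfolded levi_civita_connection_def, THEN conjunct2, THEN conjunct1, rule_format, OF X Y])
  subgoal
    by (rule lc[unfolded levi_civita_connection_def, THEN conjunct2, THEN conjunct2, rule_format, OF X Y])
  done

lemma
  assumes D: "covariant_derivative_along M T nabla \<gamma> D"
  shows covariant_derivative_along_add:
      "field_along_curve T \<gamma> V \<Longrightarrow> field_along_curve T \<gamma> W \<Longrightarrow> D (\<lambda>s. V s + W s) t = D V t + D W t"
    and covariant_derivative_along_scaleR:
      "smooth_map_on UNIV f \<Longrightarrow> field_along_curve T \<gamma> V \<Longrightarrow>
        D (\<lambda>s. f s *\<^sub>R V s) t = deriv f t *\<^sub>R V t + f t *\<^sub>R D V t"
    and covariant_derivative_along_restrict:
      "vector_field_on M T Y \<Longrightarrow> D (\<lambda>s. Y (\<gamma> s)) t = nabla (\<gamma> t) (vector_derivative \<gamma> (at t)) Y"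
  subgoal
    by (rule D[unfolded covariant_derivative_along_def, THEN conjunct2, THEN conjunct1, rule_format])
  subgoal
    by (rule D[unfolded covariant_derivative_along_def, THEN conjunct2, THEN conjunct2, THEN conjunct1,
          rule_format])
  subgoal
    by (rule D[unfolded covariant_derivative_along_def, THEN conjunct2, THEN conjunct2, THEN conjunct2,
          rule_format])
  done

text \<open>The difference \<open>d\<close> between \<open>nabla\<close> and
  \<open>left_connection\<close> is symmetric, since both have the same torsion, and skew for the
  metric, since both are metric. A trilinear form symmetric in one pair of slots and skew in another
  vanishes; definiteness of \<open>nk_inner\<close> then gives \<open>d = 0\<close>.\<close>

lemma levi_civita_left_invariant:
  assumes lc: "levi_civita_connection S3S3 tangent_S3S3 nk_metric nabla"
    and P: "P \<in> S3S3" and \<xi>: "\<xi> \<in> ImH2" and \<eta>: "\<eta> \<in> ImH2"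
  shows "nabla P (left_translate \<xi> P) (left_translate \<eta>) = left_translate (left_connection \<xi> \<eta>) P"
proof -
  define n where "n a b = trivialize P (nabla P (left_translate a P) (left_translate b))" for a b
  define d where "d a b = n a b - left_connection a b" for a b
  have n: "nabla P (left_translate a P) (left_translate b) = left_translate (n a b) P" for a b
    by (simp add: n_def left_translate_trivialize[OF P])
  have tangent: "n a b \<in> ImH2" if "a \<in> ImH2" "b \<in> ImH2" for a b
  proof -
    have "vector_field_on S3S3 tangent_S3S3 (\<lambda>P. nabla P (left_translate a P) (left_translate b))"
      by (intro levi_civita_vector_field[OF lc] vector_field_left_translate that)
    then show ?thesis
      unfolding n_def by (intro trivialize_tangent P) (use P in \<open>auto simp: vector_field_on_def\<close>)
  qed
  have deriv: "deriv_along S3S3 (left_translate b) P (left_translate a P) = left_translate b (left_translate a P)"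
    if "a \<in> ImH2" for a b
    by (rule deriv_along_eq[OF P left_translate_tangent[OF that]
          bounded_linear_imp_has_derivative[OF bounded_linear_left_translate]])
  have sym: "d a b = d b a" if "a \<in> ImH2" "b \<in> ImH2" for a b
  proof -
    have "left_translate (n a b) P - left_translate (n b a) P
        = lie_bracket S3S3 (left_translate a) (left_translate b) P"
      unfolding n[symmetric]
      by (intro levi_civita_torsion[OF lc] vector_field_left_translate that P)
    also have "\<dots> = left_translate (left_bracket a b) P"
      unfolding lie_bracket_def deriv[OF that(1)] deriv[OF that(2)]
      by (simp add: left_translate_def left_bracket_def algebra_simps)
    finally have "left_translate (n a b - n b a) P = left_translate (left_bracket a b) P"
      using linear_diff[OF linear_left_translate] by simp
    then have "n a b - n b a = left_bracket a b"
      by (metis trivialize_left_translate P)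
    then show ?thesis
      using left_connection_torsion[of a b] by (simp add: d_def algebra_simps)
  qed
  have skew: "nk_inner (d c a) b + nk_inner a (d c b) = 0"
    if "a \<in> ImH2" "b \<in> ImH2" "c \<in> ImH2" for a b c
  proof -
    \<comment> \<open>Left invariance of the metric: this function is constant on
      \<open>S3S3\<close>.\<close>
    have "((\<lambda>x. nk_metric x (left_translate a x) (left_translate b x)) has_derivative (\<lambda>v. 0)) (at P within S3S3)"
      by (rule has_derivative_transform[OF P _ has_derivative_const[of "nk_inner a b"]])
         (simp add: nk_metric_eq trivialize_left_translate)
    then have "deriv_along S3S3 (\<lambda>x. nk_metric x (left_translate a x) (left_translate b x)) P (left_translate c P) = 0"
      using deriv_along_eq[OF P left_translate_tangent[OF that(3)]] by blast
    moreover have "deriv_along S3S3 (\<lambda>x. nk_metric x (left_translate a x) (left_translate b x)) P (left_translate c P)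
        = nk_metric P (left_translate (n c a) P) (left_translate b P)
          + nk_metric P (left_translate a P) (left_translate (n c b) P)"
      unfolding n[symmetric]
      by (intro levi_civita_metric[OF lc] vector_field_left_translate left_translate_tangent that P)
    ultimately have "nk_inner (n c a) b + nk_inner a (n c b) = 0"
      by (simp add: nk_metric_eq[OF P] trivialize_left_translate[OF P])
    moreover have "nk_inner (left_connection c a) b + nk_inner a (left_connection c b) = 0"
      by (rule nk_inner_left_connection[OF that(3,1,2)])
    ultimately show ?thesis
      by (simp add: d_def nk_inner_diff_left nk_inner_commute[of a])
  qed
  \<comment> \<open>Skewness and symmetry are applied alternately, three times each; every use of
    skewness changes the sign, and the arguments return to their original places.\<close>
  have "nk_inner (d \<xi> \<eta>) c = 0" if c: "c \<in> ImH2" for c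
  proof -
    have "nk_inner (d \<xi> \<eta>) c = - nk_inner \<eta> (d \<xi> c)"
      using skew[OF \<eta> c \<xi>] by linarith
    also have "\<dots> = - nk_inner (d c \<xi>) \<eta>"
      unfolding sym[OF \<xi> c] by (subst nk_inner_commute) (rule refl)
    also have "\<dots> = nk_inner \<xi> (d c \<eta>)"
      using skew[OF \<xi> \<eta> c] by linarith
    also have "\<dots> = nk_inner (d \<eta> c) \<xi>"
      unfolding sym[OF c \<eta>] by (rule nk_inner_commute)
    also have "\<dots> = - nk_inner c (d \<eta> \<xi>)"
      using skew[OF c \<xi> \<eta>] by linarith
    also have "\<dots> = - nk_inner (d \<xi> \<eta>) c"
      unfolding sym[OF \<eta> \<xi>] by (subst nk_inner_commute) (rule refl)
    finally show ?thesis by simp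
  qed
  moreover have "d \<xi> \<eta> \<in> ImH2"
    using tangent[OF \<xi> \<eta>] left_connection_ImH2[OF \<xi> \<eta>] by (auto simp: d_def ImH2_def ImH_def)
  ultimately have "d \<xi> \<eta> = 0" using nk_inner_definite by blast
  then show ?thesis by (simp add: n d_def)
qed

section \<open>Covariant derivatives along a curve\<close>

lemma vector_derivative_ImH2:
  assumes "\<And>s. w s \<in> ImH2" "(w has_vector_derivative w') (at t)"
  shows "w' \<in> ImH2"
proof -
  have "h w' = 0" if h: "bounded_linear h" "\<And>\<xi>. \<xi> \<in> ImH2 \<Longrightarrow> h \<xi> = 0" for h :: "quat \<times> quat \<Rightarrow> real"
  proof -
    have "((\<lambda>s. h (w s)) has_vector_derivative h w') (at t)"
      by (rule bounded_linear.has_vector_derivative[OF h(1) assms(2)])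
    then have "((\<lambda>s. 0) has_vector_derivative h w') (at t)"
      using h(2)[OF assms(1)] by simp
    then show ?thesis
      using vector_derivative_unique_at[OF has_vector_derivative_const] by metis
  qed
  from this[OF bounded_linear_compose[OF bounded_linear_qRe bounded_linear_fst]]
    this[OF bounded_linear_compose[OF bounded_linear_qRe bounded_linear_snd]]
  show ?thesis
    by (simp add: ImH2_def ImH_def mem_Times_iff)
qed

lemma has_vector_derivative_trivialize:
  assumes "(f has_vector_derivative f') (at t)" "(g has_vector_derivative g') (at t)"
  shows "((\<lambda>s. trivialize (f s) (g s)) has_vector_derivative
    trivialize f' (g t) + trivialize (f t) g') (at t)"
  using has_vector_derivative_of_has_derivative[OF has_derivative_trivialize[OF
        assms[unfolded has_vector_derivative_def]]]
  by (simp add: add.commute)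

lemma velocity_tangent_S3:
  assumes "\<And>s. norm (x s) = 1" "(x has_vector_derivative x') (at t)"
  shows "x' \<in> tangent_S3 (x t)"
proof -
  have "((\<lambda>s. x s \<bullet> x s) has_vector_derivative x t \<bullet> x' + x' \<bullet> x t) (at t)"
    by (rule bounded_bilinear.has_vector_derivative[OF bounded_bilinear_inner assms(2) assms(2)])
  moreover have "(\<lambda>s. x s \<bullet> x s) = (\<lambda>s. 1)" using assms(1) by (simp add: norm_eq_1)
  ultimately have "x t \<bullet> x' + x' \<bullet> x t = 0"
    using vector_derivative_unique_at[OF has_vector_derivative_const] by metis
  then have "x t \<bullet> x' = 0" by (simp add: inner_commute)
  then show ?thesis
    by (simp only: tangent_S3_iff[OF assms(1)] qRe_qcnj_mult)
qed

lemma velocity_tangent: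
  assumes "range \<gamma> \<subseteq> S3S3" "(\<gamma> has_vector_derivative v) (at t)"
  shows "v \<in> tangent_S3S3 (\<gamma> t)"
proof -
  have in_M: "\<gamma> s \<in> S3S3" for s using assms(1) by blast
  have "fst v \<in> tangent_S3 (fst (\<gamma> t))"
    by (rule velocity_tangent_S3[of "\<lambda>s. fst (\<gamma> s)", OF S3S3_norm(1)[OF in_M]
          bounded_linear.has_vector_derivative[OF bounded_linear_fst assms(2)]])
  moreover have "snd v \<in> tangent_S3 (snd (\<gamma> t))"
    by (rule velocity_tangent_S3[of "\<lambda>s. snd (\<gamma> s)", OF S3S3_norm(2)[OF in_M]
          bounded_linear.has_vector_derivative[OF bounded_linear_snd assms(2)]])
  ultimately show ?thesis by (cases "\<gamma> t") (simp add: tangent_S3S3_def mem_Times_iff)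
qed

text \<open>The formula of \<open>nk_nabla\<close> with the derivative of a field on
  \<open>S3S3\<close> replaced by a derivative in time, so that it applies to fields given only
  along the curve.\<close>

definition nk_covariant ::
    "(real \<Rightarrow> quat \<times> quat) \<Rightarrow> (real \<Rightarrow> quat \<times> quat) \<Rightarrow> real \<Rightarrow> quat \<times> quat" where
  "nk_covariant \<gamma> V t = vector_derivative V (at t)
     + christoffel (\<gamma> t) (vector_derivative \<gamma> (at t)) (V t)"

lemma covariant_derivative_along_nk:
  assumes \<gamma>: "smooth_map_on UNIV \<gamma>" "range \<gamma> \<subseteq> S3S3"
  shows "covariant_derivative_along S3S3 tangent_S3S3 nk_nabla \<gamma> (nk_covariant \<gamma>)"
  unfolding covariant_derivative_along_def
proof (intro conjI allI impI)
  have in_M: "\<gamma> t \<in> S3S3" for t using \<gamma>(2) by blast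
  note d\<gamma> = smooth_map_on_real_has_vector_derivative[OF \<gamma>(1)]
  note tan = velocity_tangent[OF \<gamma>(2) d\<gamma>]
  {
    fix V assume V: "field_along_curve tangent_S3S3 \<gamma> V"
    then have sm: "smooth_map_on UNIV V" and ta: "\<And>t. V t \<in> tangent_S3S3 (\<gamma> t)"
      by (auto simp: field_along_curve_def)
    have "nk_covariant \<gamma> V t \<in> tangent_S3S3 (\<gamma> t)" for t
      unfolding nk_covariant_def add_christoffel[OF in_M tan]
      by (intro left_translate_tangent ImH2_add left_connection_ImH2 trivialize_tangent in_M tan ta
          vector_derivative_ImH2[OF _ has_vector_derivative_trivialize[OF d\<gamma>
              smooth_map_on_real_has_vector_derivative[OF sm]]])
    moreover have "smooth_map_on UNIV (nk_covariant \<gamma> V)"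
      unfolding nk_covariant_def[abs_def]
      by (intro smooth_map_on_add smooth_map_on_vector_derivative smooth_christoffel \<gamma>(1) sm)
    ultimately show "field_along_curve tangent_S3S3 \<gamma> (nk_covariant \<gamma> V)"
      by (simp add: field_along_curve_def)
  next
    fix V W t
    assume "field_along_curve tangent_S3S3 \<gamma> V" "field_along_curve tangent_S3S3 \<gamma> W"
    then have "((\<lambda>s. V s + W s) has_vector_derivative
        vector_derivative V (at t) + vector_derivative W (at t)) (at t)"
      by (intro has_vector_derivative_add smooth_map_on_real_has_vector_derivative)
         (auto simp: field_along_curve_def)
    then show "nk_covariant \<gamma> (\<lambda>s. V s + W s) t = nk_covariant \<gamma> V t + nk_covariant \<gamma> W t"
      by (simp add: nk_covariant_def vector_derivative_at christoffel_linear)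
  next
    fix f :: "real \<Rightarrow> real" and V t
    assume f: "smooth_map_on UNIV f" and V: "field_along_curve tangent_S3S3 \<gamma> V"
    have "(f has_real_derivative deriv f t) (at t)"
      using smooth_map_on_real_has_vector_derivative[OF f, of t]
      by (metis DERIV_imp_deriv has_real_derivative_iff_has_vector_derivative)
    then have "((\<lambda>s. f s *\<^sub>R V s) has_vector_derivative
        f t *\<^sub>R vector_derivative V (at t) + deriv f t *\<^sub>R V t) (at t)"
      using V by (intro has_vector_derivative_scaleR smooth_map_on_real_has_vector_derivative)
         (auto simp: field_along_curve_def)
    then show "nk_covariant \<gamma> (\<lambda>s. f s *\<^sub>R V s) t = deriv f t *\<^sub>R V t + f t *\<^sub>R nk_covariant \<gamma> V t"
      by (simp add: nk_covariant_def vector_derivative_at christoffel_linear scaleR_right_distrib)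
  next
    fix Y t assume "vector_field_on S3S3 tangent_S3S3 Y"
    then have "smooth_map_on S3S3 Y" by (simp add: vector_field_on_def)
    then have "(Y has_derivative deriv_along S3S3 Y (\<gamma> t)) (at (\<gamma> t) within S3S3)"
      using smooth_deriv_along in_M by blast
    from has_vector_derivative_compose_within[OF d\<gamma> \<gamma>(2) this]
    show "nk_covariant \<gamma> (\<lambda>s. Y (\<gamma> s)) t = nk_nabla (\<gamma> t) (vector_derivative \<gamma> (at t)) Y"
      by (simp add: nk_covariant_def nk_nabla_def vector_derivative_at)
  }
qed

lemma geodesic_of_euler_arnold:
  assumes sm: "smooth_map_on UNIV \<gamma>" and ea: "euler_arnold \<gamma> \<xi>"
  shows "geodesic S3S3 tangent_S3S3 nk_metric \<gamma>"
proof -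
  have in_M: "\<And>t. \<gamma> t \<in> S3S3" and im: "\<And>t. \<xi> t \<in> ImH2"
    and d\<gamma>: "\<And>t. (\<gamma> has_vector_derivative left_translate (\<xi> t) (\<gamma> t)) (at t)"
    and d\<xi>: "\<And>t. (\<xi> has_vector_derivative - left_connection (\<xi> t) (\<xi> t)) (at t)"
    using ea unfolding euler_arnold_def by auto
  have M: "range \<gamma> \<subseteq> S3S3" using in_M by auto
  let ?v = "\<lambda>t. vector_derivative \<gamma> (at t)"
  have v: "?v t = left_translate (\<xi> t) (\<gamma> t)" for t using vector_derivative_at[OF d\<gamma>] .
  have \<xi>: "(\<lambda>t. trivialize (\<gamma> t) (?v t)) = \<xi>"
    by (simp add: v trivialize_left_translate in_M)
  \<comment> \<open>The left side is the product rule for \<xi> written as the trivialized velocity,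
    the right side the second Euler-Arnold equation for the same function.
    \<open>add_christoffel\<close> then reads this as vanishing acceleration.\<close>
  have "trivialize (?v t) (?v t) + trivialize (\<gamma> t) (vector_derivative ?v (at t)) = - left_connection (\<xi> t) (\<xi> t)" for t
    using has_vector_derivative_trivialize[OF
        smooth_map_on_real_has_vector_derivative[OF sm]
        smooth_map_on_real_has_vector_derivative[OF smooth_map_on_vector_derivative[OF sm]]]
    unfolding \<xi> using d\<xi> vector_derivative_unique_at by blast
  moreover have tan: "?v t \<in> tangent_S3S3 (\<gamma> t)" for t
    using v im left_translate_tangent by metis
  ultimately have "nk_covariant \<gamma> ?v t = 0" for t
    unfolding nk_covariant_def add_christoffel[OF in_M tan] fun_cong[OF \<xi>]
    by (simp add: left_translate_def zero_prod_def)
  then show ?thesis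
    unfolding geodesic_def
    using sm M levi_civita_nk_nabla covariant_derivative_along_nk[OF sm M] by blast
qed

text \<open>The induction starts at a singleton, so \<open>D\<close> of the zero field is never
  evaluated. Closure under addition is assumed because \<open>T\<close> is an arbitrary family of
  sets here.\<close>

lemma covariant_derivative_along_sum:
  assumes D: "covariant_derivative_along M T nabla \<gamma> D"
    and B: "finite B" "B \<noteq> {}" "\<And>b. b \<in> B \<Longrightarrow> field_along_curve T \<gamma> (V b)"
    and T: "\<And>P v w. v \<in> T P \<Longrightarrow> w \<in> T P \<Longrightarrow> v + w \<in> T P"
  shows "field_along_curve T \<gamma> (\<lambda>s. \<Sum>b\<in>B. V b s) \<and> D (\<lambda>s. \<Sum>b\<in>B. V b s) t = (\<Sum>b\<in>B. D (V b) t)"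
  using B
proof (induction B rule: finite_ne_induct)
  case (insert b B)
  from insert.prems insert.IH have "field_along_curve T \<gamma> (V b)" "field_along_curve T \<gamma> (\<lambda>s. \<Sum>b\<in>B. V b s)"
    and "D (\<lambda>s. \<Sum>b\<in>B. V b s) t = (\<Sum>b\<in>B. D (V b) t)" by auto
  moreover from this have "D (\<lambda>s. V b s + (\<Sum>b\<in>B. V b s)) t = D (V b) t + D (\<lambda>s. \<Sum>b\<in>B. V b s) t"
    by (intro covariant_derivative_along_add[OF D])
  moreover from calculation have "field_along_curve T \<gamma> (\<lambda>s. V b s + (\<Sum>b\<in>B. V b s))"
    using T by (simp add: field_along_curve_def smooth_map_on_add)
  ultimately show ?case using insert.hyps by simp
qed simp

text \<open>The axioms give \<open>D\<close> explicitly on scalar multiples of restricted vector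
  fields. Writing the velocity in the left-invariant frame, with the coordinates of \<xi> as
  coefficients, makes every term accessible: the Leibniz rule produces the derivative of \<xi>, and
  \<open>levi_civita_left_invariant\<close> supplies the rest.\<close>

lemma euler_arnold_of_geodesic:
  assumes "geodesic S3S3 tangent_S3S3 nk_metric \<gamma>"
  shows "\<exists>\<xi>. euler_arnold \<gamma> \<xi>"
proof -
  let ?v = "\<lambda>t. vector_derivative \<gamma> (at t)"
  obtain nabla D where sm: "smooth_map_on UNIV \<gamma>" and M: "range \<gamma> \<subseteq> S3S3"
    and lc: "levi_civita_connection S3S3 tangent_S3S3 nk_metric nabla"
    and D: "covariant_derivative_along S3S3 tangent_S3S3 nabla \<gamma> D"
    and D0: "\<And>t. D ?v t = 0"
    using assms unfolding geodesic_def by blast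
  have in_M: "\<gamma> t \<in> S3S3" for t using M by blast
  note d\<gamma> = smooth_map_on_real_has_vector_derivative[OF sm]
  define \<xi> where "\<xi> t = trivialize (\<gamma> t) (?v t)" for t
  have v: "?v t = left_translate (\<xi> t) (\<gamma> t)" for t
    by (simp add: \<xi>_def left_translate_trivialize in_M)
  have im: "\<xi> t \<in> ImH2" for t
    unfolding \<xi>_def by (intro trivialize_tangent in_M velocity_tangent[OF M d\<gamma>])
  have sm\<xi>: "smooth_map_on UNIV \<xi>"
    unfolding \<xi>_def[abs_def] trivialize_def
    by (intro smooth_intros smooth_map_on_qcnj smooth_map_on_vector_derivative sm)
  note d\<xi> = smooth_map_on_real_has_vector_derivative[OF sm\<xi>]
  obtain B :: "(quat \<times> quat) set" where B: "finite B" "B \<subseteq> ImH2"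
    "\<And>w. w \<in> ImH2 \<Longrightarrow> w = (\<Sum>b\<in>B. (w \<bullet> b) *\<^sub>R b)"
    using ImH2_basis by blast
  have "(0, qi) \<in> ImH2" by (simp add: ImH2_def ImH_def)
  \<comment> \<open>\<open>ImH2_basis\<close> does not reveal its elements; an empty sum would force
    a nonzero vector of \<open>ImH2\<close> to vanish.\<close>
  then have "B = {} \<Longrightarrow> (0, qi) = (0 :: quat \<times> quat)"
    using B(3)[of "(0, qi)"] by simp
  then have ne: "B \<noteq> {}" by (auto simp: quat_eq_iff zero_prod_def)
  have sum_conn: "left_connection \<eta> w = (\<Sum>b\<in>B. (w \<bullet> b) *\<^sub>R left_connection \<eta> b)" if "w \<in> ImH2" for \<eta> w
    by (subst B(3)[OF that]) (simp add: linear_sum[OF linear_left_connection] linear_scale[OF linear_left_connection])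
  have sum_left: "left_translate w P = (\<Sum>b\<in>B. (w \<bullet> b) *\<^sub>R left_translate b P)" if "w \<in> ImH2" for w P
    by (subst B(3)[OF that]) (simp add: linear_sum[OF linear_left_translate] left_translate_linear)
  have sm_coeff: "smooth_map_on UNIV (\<lambda>s. \<xi> s \<bullet> b)" for b
    by (intro smooth_intros sm\<xi>)
  have deriv_coeff: "deriv (\<lambda>s. \<xi> s \<bullet> b) t = vector_derivative \<xi> (at t) \<bullet> b" for b t
    using bounded_linear.has_vector_derivative[OF bounded_linear_inner_left d\<xi>]
    by (intro DERIV_imp_deriv) (simp add: has_real_derivative_iff_has_vector_derivative)
  have field: "field_along_curve tangent_S3S3 \<gamma> (\<lambda>s. left_translate b (\<gamma> s))" if "b \<in> B" for b
    using that B(2) unfolding field_along_curve_def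
    by (auto intro!: smooth_map_on_bounded_linear[OF bounded_linear_left_translate] sm left_translate_tangent)
  have "left_translate (vector_derivative \<xi> (at t) + left_connection (\<xi> t) (\<xi> t)) (\<gamma> t) = 0" for t
  proof -
    have D_term: "D (\<lambda>s. (\<xi> s \<bullet> b) *\<^sub>R left_translate b (\<gamma> s)) t
        = (vector_derivative \<xi> (at t) \<bullet> b) *\<^sub>R left_translate b (\<gamma> t)
          + (\<xi> t \<bullet> b) *\<^sub>R left_translate (left_connection (\<xi> t) b) (\<gamma> t)" if "b \<in> B" for b
    proof -
      have "D (\<lambda>s. (\<xi> s \<bullet> b) *\<^sub>R left_translate b (\<gamma> s)) t
          = deriv (\<lambda>s. \<xi> s \<bullet> b) t *\<^sub>R left_translate b (\<gamma> t)
            + (\<xi> t \<bullet> b) *\<^sub>R D (\<lambda>s. left_translate b (\<gamma> s)) t"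
        by (rule covariant_derivative_along_scaleR[OF D sm_coeff field[OF that]])
      also have "D (\<lambda>s. left_translate b (\<gamma> s)) t = nabla (\<gamma> t) (?v t) (left_translate b)"
        by (rule covariant_derivative_along_restrict[OF D vector_field_left_translate])
           (use that B(2) in blast)
      also have "\<dots> = left_translate (left_connection (\<xi> t) b) (\<gamma> t)"
        unfolding v using levi_civita_left_invariant[OF lc in_M im] that B(2) by blast
      finally show ?thesis by (simp add: deriv_coeff)
    qed
    have "?v = (\<lambda>s. \<Sum>b\<in>B. (\<xi> s \<bullet> b) *\<^sub>R left_translate b (\<gamma> s))"
      by (rule ext) (simp only: v sum_left[OF im])
    then have "0 = D (\<lambda>s. \<Sum>b\<in>B. (\<xi> s \<bullet> b) *\<^sub>R left_translate b (\<gamma> s)) t"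
      using D0[of t] by metis
    also have "\<dots> = (\<Sum>b\<in>B. D (\<lambda>s. (\<xi> s \<bullet> b) *\<^sub>R left_translate b (\<gamma> s)) t)"
    proof (rule conjunct2[OF covariant_derivative_along_sum[OF D B(1) ne]])
      show "field_along_curve tangent_S3S3 \<gamma> (\<lambda>s. (\<xi> s \<bullet> b) *\<^sub>R left_translate b (\<gamma> s))" if "b \<in> B" for b
      proof -
        have "r *\<^sub>R b \<in> ImH2" for r using that B(2) by (auto simp: ImH2_def ImH_def)
        then show ?thesis
          using field[OF that] unfolding field_along_curve_def left_translate_linear(2)[symmetric]
          by (intro conjI allI left_translate_tangent)
             (simp_all add: left_translate_linear(2) smooth_map_on_scaleR sm_coeff)
      qed
      show "v + w \<in> tangent_S3S3 P" if vw: "v \<in> tangent_S3S3 P" "w \<in> tangent_S3S3 P" for P v w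
      proof -
        obtain \<eta> \<zeta> where "\<eta> \<in> ImH2" "v = left_translate \<eta> P" "\<zeta> \<in> ImH2" "w = left_translate \<zeta> P"
          using vw unfolding tangent_S3S3_eq by blast
        then show ?thesis
          using left_translate_tangent[OF ImH2_add] by (metis left_translate_linear(1))
      qed
    qed
    also have "\<dots> = (\<Sum>b\<in>B. (vector_derivative \<xi> (at t) \<bullet> b) *\<^sub>R left_translate b (\<gamma> t))
        + (\<Sum>b\<in>B. (\<xi> t \<bullet> b) *\<^sub>R left_translate (left_connection (\<xi> t) b) (\<gamma> t))"
      by (simp add: D_term sum.distrib)
    also have "\<dots> = left_translate (vector_derivative \<xi> (at t)) (\<gamma> t)
        + left_translate (left_connection (\<xi> t) (\<xi> t)) (\<gamma> t)"
      unfolding sum_left[OF vector_derivative_ImH2[OF im d\<xi>]] sum_conn[OF im]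
      by (simp add: linear_sum[OF linear_left_translate] left_translate_linear)
    finally show ?thesis by (simp add: left_translate_linear)
  qed
  then have "vector_derivative \<xi> (at t) + left_connection (\<xi> t) (\<xi> t) = trivialize (\<gamma> t) 0" for t
    by (metis trivialize_left_translate in_M)
  then have "vector_derivative \<xi> (at t) = - left_connection (\<xi> t) (\<xi> t)" for t
    by (simp add: trivialize_def eq_neg_iff_add_eq_0 zero_prod_def)
  then show ?thesis
    using in_M im d\<gamma> d\<xi> v unfolding euler_arnold_def by metis
qed

section \<open>Uniqueness of solutions of the Euler-Arnold system\<close>

lemma has_vector_derivative_zero_imp_constant:
  fixes f :: "real \<Rightarrow> 'a::real_normed_vector"
  assumes "\<And>t. (f has_vector_derivative 0) (at t)"
  shows "f s = f t"
  using has_derivative_zero_unique[OF convex_UNIV, of f s t] assms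
  by (simp add: has_vector_derivative_def)

text \<open>On equal arguments the bracket vanishes and \<open>cross_term\<close> is twice a
  commutator; 2/6 is the factor 1/3 of the geodesic equation.\<close>

lemma minus_left_connection_self:
  "- left_connection \<xi> \<xi> =
    ((1/3) *\<^sub>R (fst \<xi> * snd \<xi> - snd \<xi> * fst \<xi>), - ((1/3) *\<^sub>R (fst \<xi> * snd \<xi> - snd \<xi> * fst \<xi>)))"
  by (simp add: left_connection_def left_bracket_def cross_term_def quat_eq_iff algebra_simps)

lemma euler_arnold_split:
  "euler_arnold \<gamma> \<xi> \<longleftrightarrow> (\<forall>t. \<gamma> t \<in> S3S3 \<and> \<xi> t \<in> ImH2 \<and>
     ((\<lambda>s. fst (\<gamma> s)) has_vector_derivative fst (\<gamma> t) * fst (\<xi> t)) (at t) \<and>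
     ((\<lambda>s. snd (\<gamma> s)) has_vector_derivative snd (\<gamma> t) * snd (\<xi> t)) (at t) \<and>
     ((\<lambda>s. fst (\<xi> s)) has_vector_derivative
        (1/3) *\<^sub>R (fst (\<xi> t) * snd (\<xi> t) - snd (\<xi> t) * fst (\<xi> t))) (at t) \<and>
     ((\<lambda>s. snd (\<xi> s)) has_vector_derivative
        - ((1/3) *\<^sub>R (fst (\<xi> t) * snd (\<xi> t) - snd (\<xi> t) * fst (\<xi> t)))) (at t))"
proof -
  have pair: "(f has_vector_derivative (a, b)) (at t) \<longleftrightarrow>
      ((\<lambda>s. fst (f s)) has_vector_derivative a) (at t) \<and> ((\<lambda>s. snd (f s)) has_vector_derivative b) (at t)"
    for f :: "real \<Rightarrow> quat \<times> quat" and a b t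
  proof
    assume f: "(f has_vector_derivative (a, b)) (at t)"
    show "((\<lambda>s. fst (f s)) has_vector_derivative a) (at t) \<and> ((\<lambda>s. snd (f s)) has_vector_derivative b) (at t)"
      using bounded_linear.has_vector_derivative[OF bounded_linear_fst f]
        bounded_linear.has_vector_derivative[OF bounded_linear_snd f] by simp
  next
    assume "((\<lambda>s. fst (f s)) has_vector_derivative a) (at t) \<and> ((\<lambda>s. snd (f s)) has_vector_derivative b) (at t)"
    then show "(f has_vector_derivative (a, b)) (at t)"
      using has_vector_derivative_Pair[of "\<lambda>s. fst (f s)" a t UNIV "\<lambda>s. snd (f s)" b] by simp
  qed
  show ?thesis
    unfolding euler_arnold_def minus_left_connection_self left_translate_def pair by (simp add: conj_assoc)
qed

text \<open>The product of \<open>x\<close> with the conjugate of \<open>z\<close> is constant: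
  conjugating the equation for \<open>z\<close> turns the imaginary right factor \<alpha> into the
  left factor -\<alpha>, which cancels.\<close>

lemma left_ode_unique:
  assumes "\<And>t. norm (x t) = 1" "\<And>t. norm (z t) = 1" "\<And>t. qRe (\<alpha> t) = 0"
    and x: "\<And>t. (x has_vector_derivative x t * \<alpha> t) (at t)"
    and z: "\<And>t. (z has_vector_derivative z t * \<alpha> t) (at t)"
    and init: "x t0 = z t0"
  shows "x t = z t"
proof -
  have "((\<lambda>s. x s * qcnj (z s)) has_vector_derivative
      x t * qcnj (z t * \<alpha> t) + (x t * \<alpha> t) * qcnj (z t)) (at t)" for t
    by (rule bounded_bilinear.has_vector_derivative[OF bounded_bilinear_mult x
          bounded_linear.has_vector_derivative[OF bounded_linear_qcnj z]])
  moreover have "x t * qcnj (z t * \<alpha> t) + (x t * \<alpha> t) * qcnj (z t) = 0" for t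
    by (simp add: qcnj_mult qcnj_imaginary assms(3) mult.assoc)
  ultimately have "x t * qcnj (z t) = x t0 * qcnj (z t0)"
    by (intro has_vector_derivative_zero_imp_constant[of "\<lambda>s. x s * qcnj (z s)"]) metis
  also have "\<dots> = 1" unfolding init by (rule unit_mult_qcnj[OF assms(2)])
  finally have "x t * (qcnj (z t) * z t) = z t" by (simp add: mult.assoc[symmetric])
  then show ?thesis by (simp add: qcnj_mult_unit assms(2))
qed

lemma inner_commutator: "x \<bullet> (x * y - y * x) = 0" for x y :: quat
  by (simp add: inner_quat_def algebra_simps)

text \<open>The system for \<xi> is quadratic, but the sum of its components is conserved, and both
  solutions share its value \<open>s\<close>. Replacing the second component by \<open>s\<close>
  minus the first makes the equation linear, so the difference \<open>e\<close> satisfies e' =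
  [e, s]/3. A commutator with \<open>e\<close> is orthogonal to \<open>e\<close>, hence its norm is
  constant and stays zero; no Gronwall estimate is needed.\<close>

lemma euler_arnold_unique:
  assumes ea: "euler_arnold \<gamma> \<xi>" "euler_arnold \<delta> \<eta>" and init: "\<gamma> t0 = \<delta> t0" "\<xi> t0 = \<eta> t0"
  shows "\<gamma> t = \<delta> t"
proof -
  note 1 = ea(1)[unfolded euler_arnold_split, rule_format]
  note 2 = ea(2)[unfolded euler_arnold_split, rule_format]
  have im: "qRe (fst (\<xi> t)) = 0" "qRe (snd (\<xi> t)) = 0" "qRe (fst (\<eta> t)) = 0" "qRe (snd (\<eta> t)) = 0" for t
    using 1[of t] 2[of t] by (auto simp: ImH2_def ImH_def)
  have sum_const: "fst (\<xi> t) + snd (\<xi> t) = fst (\<eta> t) + snd (\<eta> t)" for t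
  proof -
    have "((\<lambda>s. fst (\<xi> s) + snd (\<xi> s)) has_vector_derivative 0) (at t)"
      "((\<lambda>s. fst (\<eta> s) + snd (\<eta> s)) has_vector_derivative 0) (at t)" for t
      using has_vector_derivative_add[of "\<lambda>s. fst (\<xi> s)" _ "at t" "\<lambda>s. snd (\<xi> s)"]
        has_vector_derivative_add[of "\<lambda>s. fst (\<eta> s)" _ "at t" "\<lambda>s. snd (\<eta> s)"] 1[of t] 2[of t]
      by fastforce+
    from has_vector_derivative_zero_imp_constant[OF this(1), of t t0]
      has_vector_derivative_zero_imp_constant[OF this(2), of t t0]
    have "fst (\<xi> t) + snd (\<xi> t) = fst (\<xi> t0) + snd (\<xi> t0)"
      "fst (\<eta> t) + snd (\<eta> t) = fst (\<eta> t0) + snd (\<eta> t0)" .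
    then show ?thesis using init(2) by simp
  qed
  define e where "e t = fst (\<xi> t) - fst (\<eta> t)" for t
  define s where "s t = fst (\<xi> t) + snd (\<xi> t)" for t
  have de: "(e has_vector_derivative (1/3) *\<^sub>R (e t * s t - s t * e t)) (at t)" for t
  proof -
    have \<xi>: "snd (\<xi> t) = s t - fst (\<xi> t)" by (simp add: s_def)
    have \<eta>: "snd (\<eta> t) = s t - fst (\<eta> t)" by (simp add: s_def sum_const)
    \<comment> \<open>The squares cancel: [\<alpha>, s - \<alpha>] = [\<alpha>, s].\<close>
    have "(1/3) *\<^sub>R (e t * s t - s t * e t) =
        (1/3) *\<^sub>R (fst (\<xi> t) * snd (\<xi> t) - snd (\<xi> t) * fst (\<xi> t))
        - (1/3) *\<^sub>R (fst (\<eta> t) * snd (\<eta> t) - snd (\<eta> t) * fst (\<eta> t))"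
      unfolding \<xi> \<eta> e_def by (simp add: algebra_simps)
    then show ?thesis
      unfolding e_def[abs_def] using 1[of t] 2[of t] by (auto intro: has_vector_derivative_diff)
  qed
  have "((\<lambda>t. e t \<bullet> e t) has_vector_derivative 0) (at t)" for t
  proof -
    have "e t \<bullet> ((1/3) *\<^sub>R (e t * s t - s t * e t)) = 0"
      by (simp add: inner_commutator)
    then show ?thesis
      using bounded_bilinear.has_vector_derivative[OF bounded_bilinear_inner de[of t] de[of t]]
      by (simp only: inner_commute add_0)
  qed
  then have "e t \<bullet> e t = e t0 \<bullet> e t0" for t
    by (rule has_vector_derivative_zero_imp_constant)
  then have "e t = 0" for t using init(2) by (simp add: e_def)
  then have eq: "fst (\<eta> t) = fst (\<xi> t)" "snd (\<eta> t) = snd (\<xi> t)" for t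
    using sum_const[of t] by (simp_all add: e_def)
  have n: "norm (fst (\<gamma> t)) = 1" "norm (snd (\<gamma> t)) = 1" "norm (fst (\<delta> t)) = 1" "norm (snd (\<delta> t)) = 1" for t
    using 1[of t] 2[of t] S3S3_norm by auto
  have "fst (\<gamma> t) = fst (\<delta> t)"
    by (rule left_ode_unique[of _ _ "\<lambda>t. fst (\<xi> t)" t0])
       (use n im 1 2 eq init(1) in \<open>simp_all del: quat_ring_sel\<close>)
  moreover have "snd (\<gamma> t) = snd (\<delta> t)"
    by (rule left_ode_unique[of _ _ "\<lambda>t. snd (\<xi> t)" t0])
       (use n im 1 2 eq init(1) in \<open>simp_all del: quat_ring_sel\<close>)
  ultimately show ?thesis by (simp add: prod_eq_iff)
qed

lemma euler_arnold_nonconstant: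
  assumes ea: "euler_arnold \<gamma> \<xi>" and nz: "\<xi> t \<noteq> 0"
  shows "\<not> (\<exists>P. \<forall>t. \<gamma> t = P)"
proof
  assume "\<exists>P. \<forall>t. \<gamma> t = P"
  then obtain P where "\<gamma> = (\<lambda>t. P)" by blast
  then have "((\<lambda>t. P) has_vector_derivative left_translate (\<xi> t) P) (at t)" "P \<in> S3S3"
    using ea by (auto simp: euler_arnold_def)
  then have "left_translate (\<xi> t) P = left_translate 0 P" "P \<in> S3S3"
    using vector_derivative_unique_at[OF has_vector_derivative_const]
    by (metis linear_0[OF linear_left_translate])+
  then show False using nz by (metis trivialize_left_translate)
qed

section \<open>Symmetries: time shift and conjugation\<close>

lemma Ck_on_shift:
  fixes f :: "real \<Rightarrow> 'a::real_normed_vector"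
  assumes "open U" "Ck_on n U f"
  shows "Ck_on n ((\<lambda>t. t - a) -` U) (\<lambda>t. f (t - a))"
  using assms(2)
proof (induction n arbitrary: f)
  case 0
  then show ?case
    by (auto intro!: continuous_on_compose2[of U f] continuous_intros)
next
  case (Suc n)
  have V: "open ((\<lambda>t. t - a) -` U)"
    by (intro open_vimage assms(1) continuous_intros)
  show ?case
  proof (rule Ck_on_SucI[OF V])
    show "((\<lambda>t. f (t - a)) has_derivative frechet_derivative f (at (x - a))) (at x)"
      if "x \<in> (\<lambda>t. t - a) -` U" for x
    proof -
      have "((\<lambda>t. t - a) has_derivative (\<lambda>v. v)) (at x)"
        by (auto intro!: derivative_eq_intros)
      then show ?thesis
        using has_derivative_compose[OF _ Ck_on_has_derivative[OF assms(1) Suc.prems]] that by auto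
    qed
    show "Ck_on n ((\<lambda>t. t - a) -` U) (\<lambda>x. frechet_derivative f (at (x - a)) v)" for v
      using Suc.IH[of "\<lambda>x. frechet_derivative f (at x) v"] Suc.prems by simp
  qed
qed

lemma smooth_map_on_shift:
  fixes f :: "real \<Rightarrow> 'a::real_normed_vector"
  assumes "smooth_map_on UNIV f"
  shows "smooth_map_on UNIV (\<lambda>t. f (t - a))"
proof (rule smooth_map_onI)
  fix p :: real
  obtain U F where U: "open U" "p - a \<in> U" "\<And>n. Ck_on n U F" "\<And>x. x \<in> U \<Longrightarrow> F x = f x"
    using smooth_map_onE[OF assms, of "p - a"] by auto
  have "open ((\<lambda>t. t - a) -` U)"
    by (intro open_vimage U(1) continuous_intros)
  then show "\<exists>U F. open U \<and> p \<in> U \<and> (\<forall>n. Ck_on n U F) \<and> (\<forall>x\<in>U \<inter> UNIV. F x = f (x - a))"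
    using U Ck_on_shift[OF U(1) U(3)]
    by (intro exI[of _ "(\<lambda>t. t - a) -` U"] exI[of _ "\<lambda>t. F (t - a)"]) auto
qed

lemma bounded_linear_conj_pair: "bounded_linear (conj_pair h)"
proof -
  have eq: "conj_pair h = (\<lambda>z. (h * fst z * inverse h, h * snd z * inverse h))"
    by (simp add: conj_pair_def case_prod_beta fun_eq_iff)
  show ?thesis
    unfolding eq
    by (intro bounded_linear_Pair bounded_linear_mult_const bounded_linear_const_mult
        bounded_linear_fst bounded_linear_snd)
qed

text \<open>Conjugation by \<open>h\<close> is an algebra automorphism preserving the norm and the
  imaginary quaternions, so it commutes with left translation and with commutators; the system is
  autonomous, which allows the shift.\<close>

lemma euler_arnold_conj_shift:
  assumes h: "h \<in> S3" and ea: "euler_arnold \<gamma> \<xi>"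
  shows "euler_arnold (\<lambda>t. conj_pair h (\<gamma> (t - t0))) (\<lambda>t. conj_pair h (\<xi> (t - t0)))"
proof -
  have n: "norm h = 1" using h by (simp add: S3_def)
  then have hh: "h \<noteq> 0" by auto
  then have can: "inverse h * (h * x) = x" for x by (simp add: mult.assoc[symmetric])
  have trans: "conj_pair h (left_translate \<eta> P) = left_translate (conj_pair h \<eta>) (conj_pair h P)" for \<eta> P
    by (simp add: conj_pair_def left_translate_def case_prod_beta mult.assoc can)
  have conn: "conj_pair h (- left_connection \<eta> \<eta>) = - left_connection (conj_pair h \<eta>) (conj_pair h \<eta>)" for \<eta>
    unfolding minus_left_connection_self
    by (simp add: conj_pair_def case_prod_beta mult.assoc can right_diff_distrib left_diff_distrib)
  have norm: "conj_pair h P \<in> S3S3" if "P \<in> S3S3" for P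
    using that n by (auto simp: conj_pair_def S3S3_def S3_def norm_mult norm_inverse)
  have re: "qRe (h * x * inverse h) = 0" if "qRe x = 0" for x
  proof -
    \<comment> \<open>The real part behaves like a trace: cyclic permutation cancels
      \<open>h\<close>.\<close>
    have "qRe (h * x * inverse h) = qRe (inverse h * (h * x))" by (rule qRe_commutator)
    then show ?thesis using that by (simp add: can del: quat_ring_sel)
  qed
  have im: "conj_pair h \<eta> \<in> ImH2" if "\<eta> \<in> ImH2" for \<eta>
    using that by (auto simp: conj_pair_def ImH2_def ImH_def re simp del: quat_ring_sel)
  have shift: "((\<lambda>t. conj_pair h (f (t - t0))) has_vector_derivative conj_pair h v) (at t)"
    if "(f has_vector_derivative v) (at (t - t0))" for f v t
  proof -
    have "((\<lambda>t. t - t0) has_vector_derivative 1) (at t)"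
      by (auto intro!: derivative_eq_intros)
    then have "((\<lambda>t. f (t - t0)) has_vector_derivative v) (at t)"
      using vector_diff_chain_at[of "\<lambda>t. t - t0" 1 t f v] that by (simp add: o_def)
    then show ?thesis by (rule bounded_linear.has_vector_derivative[OF bounded_linear_conj_pair])
  qed
  show ?thesis
    using ea unfolding euler_arnold_def trans[symmetric] conn[symmetric]
    by (blast intro: norm im shift)
qed

section \<open>The three families\<close>

definition qexp :: "real \<Rightarrow> quat" where
  "qexp \<theta> = Quat (cos \<theta>) (sin \<theta>) 0 0"

lemma qexp_sel [simp]:
  "qRe (qexp t) = cos t" "qIm1 (qexp t) = sin t" "qIm2 (qexp t) = 0" "qIm3 (qexp t) = 0"
  by (simp_all add: qexp_def)

lemma norm_qexp [simp]: "norm (qexp t) = 1"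
  by (simp add: norm_quat_def inner_quat_def power2_eq_square[symmetric])

lemma qRe_of_real [simp]:
  "qRe (of_real r) = r" "qIm1 (of_real r) = 0" "qIm2 (of_real r) = 0" "qIm3 (of_real r) = 0"
  by (simp_all add: of_real_def)

lemma qexp_eq: "of_real (cos t) + sin t *\<^sub>R qi = qexp t"
  by (simp add: quat_eq_iff)

lemma quat_components: "x = qRe x *\<^sub>R 1 + qIm1 x *\<^sub>R qi + qIm2 x *\<^sub>R qj + qIm3 x *\<^sub>R qk"
  by (simp add: quat_eq_iff)

lemma has_vector_derivative_quat:
  fixes x :: "real \<Rightarrow> quat"
  assumes "((\<lambda>s. qRe (x s)) has_real_derivative qRe x') (at t)" "((\<lambda>s. qIm1 (x s)) has_real_derivative qIm1 x') (at t)"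
    "((\<lambda>s. qIm2 (x s)) has_real_derivative qIm2 x') (at t)" "((\<lambda>s. qIm3 (x s)) has_real_derivative qIm3 x') (at t)"
  shows "(x has_vector_derivative x') (at t)"
proof -
  have "((\<lambda>s. qRe (x s) *\<^sub>R 1 + qIm1 (x s) *\<^sub>R qi + qIm2 (x s) *\<^sub>R qj + qIm3 (x s) *\<^sub>R qk) has_vector_derivative
      qRe x' *\<^sub>R 1 + qIm1 x' *\<^sub>R qi + qIm2 x' *\<^sub>R qj + qIm3 x' *\<^sub>R qk) (at t)"
    using assms by (auto intro!: derivative_eq_intros)
  then show ?thesis by (simp add: quat_components[symmetric])
qed

lemma smooth_qexp: "smooth_map_on M (\<lambda>t. qexp (a * t))"
  unfolding qexp_eq[symmetric] of_real_def
  by (intro smooth_intros smooth_map_on_cos_sin)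

lemma smooth_curve3: "smooth_map_on M (curve3 \<phi> A B)"
  unfolding curve3_def[abs_def] of_real_def
  by (intro smooth_intros smooth_map_on_cos_sin)

lemma euler_arnold_circle:
  "euler_arnold (\<lambda>t. (qexp (a * t), qexp (a' * t))) (\<lambda>t. (a *\<^sub>R qi, a' *\<^sub>R qi))"
proof -
  have "((\<lambda>s. qexp (a * s)) has_vector_derivative qexp (a * t) * (a *\<^sub>R qi)) (at t)" for a t
    by (rule has_vector_derivative_quat) (auto intro!: derivative_eq_intros)
  then show ?thesis
    unfolding euler_arnold_split
    by (simp add: S3S3_def S3_def ImH2_def ImH_def mult.commute[of a a'])
qed

text \<open>Shows that the curves of the third family stay on the sphere without expanding their
  formula: \<open>x\<close> and \<open>x * \<alpha>\<close> are orthogonal when \<alpha> is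
  imaginary.\<close>

lemma unit_of_left_ode:
  assumes "\<And>t. qRe (\<alpha> t) = 0" and x: "\<And>t. (x has_vector_derivative x t * \<alpha> t) (at t)"
    and init: "x t0 = 1"
  shows "norm (x t) = 1"
proof -
  have "((\<lambda>s. x s \<bullet> x s) has_vector_derivative x t \<bullet> (x t * \<alpha> t) + (x t * \<alpha> t) \<bullet> x t) (at t)" for t
    by (rule bounded_bilinear.has_vector_derivative[OF bounded_bilinear_inner x x])
  moreover have "x t \<bullet> (x t * \<alpha> t) = 0" for t
    using assms(1)[of t] by (simp add: inner_quat_def algebra_simps)
  ultimately have "((\<lambda>s. x s \<bullet> x s) has_vector_derivative 0) (at t)" for t
    by (simp add: inner_commute)
  then have "x t \<bullet> x t = x t0 \<bullet> x t0"
    by (rule has_vector_derivative_zero_imp_constant)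
  moreover have "(1 :: quat) \<bullet> 1 = 1" by (simp add: inner_quat_def)
  ultimately show ?thesis by (simp add: init norm_eq_1)
qed

text \<open>The proof rests on \<open>curve3 \<phi> A B t = (1 + \<phi> k) (exp (A t i) - \<phi> k exp (B t i)) / (1 + \<phi>\<^sup>2)\<close>;
  the first two hypotheses are how the constants of \<^const>\<open>family3\<close> enter.\<close>

lemma curve3_has_vector_derivative:
  assumes A: "A = a + \<phi> * b" and B: "\<phi> * B = \<phi> * a - b" and c: "c = A + B"
  shows "(curve3 \<phi> A B has_vector_derivative
    curve3 \<phi> A B t * (a *\<^sub>R qi + b *\<^sub>R (cos (c * t) *\<^sub>R qj - sin (c * t) *\<^sub>R qk))) (at t)"
proof -
  \<comment> \<open>This is exp(A t i) - \<phi> k exp(B t i). The constant left factor 1 + \<phi> k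
    and the scalar do not affect an equation of the form w' = w u.\<close>
  define w where "w t = Quat (cos (A * t)) (sin (A * t)) (- \<phi> * sin (B * t)) (- \<phi> * cos (B * t))" for t
  have eq: "curve3 \<phi> A B t = (1 / (1 + \<phi>\<^sup>2)) *\<^sub>R ((1 + \<phi> *\<^sub>R qk) * w t)" for t
    unfolding curve3_def w_def of_real_def quat_eq_iff by (simp add: field_simps power2_eq_square)
  \<comment> \<open>The rotating term is b exp(-c t i) j. Multiplication by it exchanges the two
    frequencies because c = A + B. Comparing the coefficients of i exp(A t i) and j exp(B t i) in w'
    = w u gives precisely the hypotheses \<open>A\<close> and \<open>B\<close>.\<close>
  have A': "sin (A * t) = sin (c * t) * cos (B * t) - cos (c * t) * sin (B * t)"
    "cos (A * t) = cos (c * t) * cos (B * t) + sin (c * t) * sin (B * t)"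
    using sin_diff[of "c * t" "B * t"] cos_diff[of "c * t" "B * t"] by (simp_all add: c algebra_simps)
  have B': "sin (B * t) = sin (c * t) * cos (A * t) - cos (c * t) * sin (A * t)"
    "cos (B * t) = cos (c * t) * cos (A * t) + sin (c * t) * sin (A * t)"
    using sin_diff[of "c * t" "A * t"] cos_diff[of "c * t" "A * t"] by (simp_all add: c algebra_simps)
  have w: "(w has_vector_derivative w t * (a *\<^sub>R qi + b *\<^sub>R (cos (c * t) *\<^sub>R qj - sin (c * t) *\<^sub>R qk))) (at t)"
    (is "(_ has_vector_derivative ?w') _")
  proof (rule has_vector_derivative_quat)
    have "A * sin (A * t) = a * sin (A * t)
        + \<phi> * b * (sin (c * t) * cos (B * t) - cos (c * t) * sin (B * t))"
      unfolding A'(1)[symmetric] by (simp add: A distrib_right)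
    then have "- (A * sin (A * t)) = qRe ?w'"
      by (simp add: w_def algebra_simps)
    then show "((\<lambda>s. qRe (w s)) has_real_derivative qRe ?w') (at t)"
      unfolding w_def by (auto intro!: derivative_eq_intros simp: ac_simps)
    have "A * cos (A * t) = a * cos (A * t)
        + \<phi> * b * (cos (c * t) * cos (B * t) + sin (c * t) * sin (B * t))"
      unfolding A'(2)[symmetric] by (simp add: A distrib_right)
    then have "A * cos (A * t) = qIm1 ?w'"
      by (simp add: w_def algebra_simps)
    then show "((\<lambda>s. qIm1 (w s)) has_real_derivative qIm1 ?w') (at t)"
      unfolding w_def by (auto intro!: derivative_eq_intros simp: ac_simps)
    have "\<phi> * B * cos (B * t) = \<phi> * a * cos (B * t)
        - b * (cos (c * t) * cos (A * t) + sin (c * t) * sin (A * t))"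
      unfolding B'(2)[symmetric] by (simp add: B left_diff_distrib)
    then have "- (\<phi> * B * cos (B * t)) = qIm2 ?w'"
      by (simp add: w_def algebra_simps)
    then show "((\<lambda>s. qIm2 (w s)) has_real_derivative qIm2 ?w') (at t)"
      unfolding w_def by (auto intro!: derivative_eq_intros simp: ac_simps)
    have "\<phi> * B * sin (B * t) = \<phi> * a * sin (B * t)
        - b * (sin (c * t) * cos (A * t) - cos (c * t) * sin (A * t))"
      unfolding B'(1)[symmetric] by (simp add: B left_diff_distrib)
    then have "\<phi> * B * sin (B * t) = qIm3 ?w'"
      by (simp add: w_def algebra_simps)
    then show "((\<lambda>s. qIm3 (w s)) has_real_derivative qIm3 ?w') (at t)"
      unfolding w_def by (auto intro!: derivative_eq_intros simp: ac_simps)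
  qed
  show ?thesis
    using bounded_linear.has_vector_derivative[OF bounded_linear_scaleR_right[of "1 / (1 + \<phi>\<^sup>2)"]
        has_vector_derivative_mult_right[OF w, of "1 + \<phi> *\<^sub>R qk"]]
    unfolding eq[abs_def] by (simp add: mult.assoc)
qed

lemma curve3_zero: "curve3 \<phi> A B 0 = 1"
proof -
  have "1 / (1 + \<phi>\<^sup>2) + \<phi>\<^sup>2 / (1 + \<phi>\<^sup>2) = 1"
    by (simp add: add_divide_distrib[symmetric] add_nonneg_eq_0_iff)
  then show ?thesis
    unfolding curve3_def of_real_def quat_eq_iff by simp
qed

text \<open>Both velocities contain the same rotating unit vector v orthogonal to i, with opposite
  coefficients, so their sum (a + a') i is constant and their commutator is -b (a + a') [i, v].
  Since [i, v] = 2 i v, the factor 1/3 of the equation makes the angular speed \<open>c\<close>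
  equal to 2/3 (a + a').\<close>

lemma euler_arnold_curve3:
  assumes "A = a + \<phi> * b" "\<phi> * B = \<phi> * a - b" "c = A + B"
    and "A' = a' + \<phi>' * b'" "\<phi>' * B' = \<phi>' * a' - b'" "c = A' + B'"
    and b': "b' = - b" and c: "c = 2/3 * (a + a')"
  shows "euler_arnold (\<lambda>t. (curve3 \<phi> A B t, curve3 \<phi>' A' B' t))
    (\<lambda>t. (a *\<^sub>R qi + b *\<^sub>R (cos (c * t) *\<^sub>R qj - sin (c * t) *\<^sub>R qk),
          a' *\<^sub>R qi + b' *\<^sub>R (cos (c * t) *\<^sub>R qj - sin (c * t) *\<^sub>R qk)))"
proof -
  let ?u = "\<lambda>a b t. a *\<^sub>R qi + b *\<^sub>R (cos (c * t) *\<^sub>R qj - sin (c * t) *\<^sub>R qk)"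
  note 1 = curve3_has_vector_derivative[OF assms(1-3)]
  note 2 = curve3_has_vector_derivative[OF assms(4-6)]
  have re: "qRe (?u a b t) = 0" for a b t by simp
  have n: "norm (curve3 \<phi> A B t) = 1" "norm (curve3 \<phi>' A' B' t) = 1" for t
    using unit_of_left_ode[OF re 1 curve3_zero] unit_of_left_ode[OF re 2 curve3_zero] by auto
  have du: "(?u a b has_vector_derivative b *\<^sub>R (- (c * sin (c * t)) *\<^sub>R qj - (c * cos (c * t)) *\<^sub>R qk)) (at t)"
    for a b t
    by (auto intro!: derivative_eq_intros simp: algebra_simps)
  have comm: "(1/3) *\<^sub>R (?u a b t * ?u a' b' t - ?u a' b' t * ?u a b t)
      = b *\<^sub>R (- (c * sin (c * t)) *\<^sub>R qj - (c * cos (c * t)) *\<^sub>R qk)" for t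
    by (simp add: quat_eq_iff b' c algebra_simps)
  have neg: "- (b *\<^sub>R z) = b' *\<^sub>R z" for z :: quat by (simp add: b')
  show ?thesis
    unfolding euler_arnold_split fst_conv snd_conv comm neg
    using n 1 2 du re by (auto simp: S3S3_def S3_def ImH2_def ImH_def simp del: quat_ring_sel)
qed

text \<open>\<open>A\<close> and \<open>B\<close> are the eigenvalues of the symmetric matrix with
  rows (a, b) and (b, c - a), and (1, \<phi>) is an eigenvector for \<open>A\<close>. The three
  conclusions are its two eigenvector equations, with A = c - B in the second, and the
  trace.\<close>

lemma family3_constants:
  fixes a b c :: real
  assumes b: "b \<noteq> 0"
    and A: "A = (c + sqrt ((2 * a - c)\<^sup>2 + 4 * b\<^sup>2)) / 2"
    and B: "B = (c - sqrt ((2 * a - c)\<^sup>2 + 4 * b\<^sup>2)) / 2"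
    and \<phi>: "\<phi> = (c - 2 * a + sqrt ((c - 2 * a)\<^sup>2 + 4 * b\<^sup>2)) / (2 * b)"
  shows "A = a + \<phi> * b" "\<phi> * B = \<phi> * a - b" "c = A + B"
proof -
  define r where "r = sqrt ((2 * a - c)\<^sup>2 + 4 * b\<^sup>2)"
  have r: "r\<^sup>2 = (2 * a - c)\<^sup>2 + 4 * b\<^sup>2" by (simp add: r_def)
  have e: "A = (c + r) / 2" "B = (c - r) / 2" "\<phi> * b = (c - 2 * a + r) / 2"
    using b by (simp_all add: A B \<phi> r_def power2_commute[of c])
  then show "A = a + \<phi> * b" "c = A + B" by (simp_all add: field_simps)
  \<comment> \<open>The characteristic polynomial at \<open>a\<close>: (A - a)(a - B) = b^2.\<close>
  have "(\<phi> * b) * (a - B) = b * b"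
    unfolding e using r by (simp add: field_simps power2_eq_square)
  then have "b * (\<phi> * (a - B)) = b * b" by (simp add: algebra_simps)
  then have "\<phi> * (a - B) = b" using b by simp
  then show "\<phi> * B = \<phi> * a - b" by (simp add: algebra_simps)
qed

text \<open>Because u and i both square to -1, 1 - u i intertwines them. It vanishes exactly for u =
  -i, where \<open>qj\<close> serves instead.\<close>

lemma rotate_qi:
  assumes "norm u = 1" "qRe u = 0"
  shows "\<exists>h. norm h = 1 \<and> h * qi = u * h"
proof (cases "u = - qi")
  case True
  then show ?thesis
    by (intro exI[of _ qj]) (simp add: quat_eq_iff norm_quat_def inner_quat_def)
next
  case False
  let ?g = "1 - u * qi"
  have "u \<bullet> u = 1" using assms(1) by (simp add: norm_eq_1)
  then have uu: "u * u = - 1" using assms(2) by (simp add: quat_eq_iff inner_quat_def)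
  have "?g \<noteq> 0"
  proof
    assume "?g = 0"
    then have "u * qi * qi = 1 * qi" by simp
    then have "- u = qi" by (simp add: mult.assoc quat_units)
    then show False using False by (metis minus_minus)
  qed
  moreover have "?g * qi = u * ?g"
  proof -
    have "?g * qi = qi + u" by (simp add: left_diff_distrib mult.assoc quat_units)
    moreover have "u * ?g = u + qi" by (simp add: right_diff_distrib mult.assoc[symmetric] uu)
    ultimately show ?thesis by simp
  qed
  ultimately show ?thesis
    by (intro exI[of _ "sgn ?g"]) (simp add: norm_sgn sgn_div_norm)
qed

text \<open>After i has been moved to \<open>u\<close>, pulling \<open>f\<close> back gives a unit
  vector \<open>g\<close> in the plane of j and k. The remaining rotation is about i, hence
  conjugation by some exp(t i/2), which leaves the first condition intact.\<close>

lemma rotate_qi_qj: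
  assumes u: "norm u = 1" "qRe u = 0" and f: "norm f = 1" "qRe f = 0" and uf: "u \<bullet> f = 0"
  shows "\<exists>h. norm h = 1 \<and> h * qi = u * h \<and> h * qj = f * h"
proof -
  obtain h where h: "norm h = 1" "h * qi = u * h" using rotate_qi[OF u] by blast
  define g where "g = qcnj h * (f * h)"
  have hg: "h * g = f * h" by (simp add: g_def unit_mult_qcnj_left[OF h(1)])
  have ng: "g \<bullet> g = 1"
    unfolding norm_eq_1[symmetric] by (simp add: g_def norm_mult h f)
  have g0: "qRe g = 0"
  proof -
    have "qRe g = qRe (f * h * qcnj h)" unfolding g_def by (rule qRe_commutator)
    then show ?thesis by (simp add: mult.assoc unit_mult_qcnj h(1) f(2) del: quat_ring_sel)
  qed
  have g1: "qIm1 g = 0"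
  proof -
    have "qi \<bullet> g = (h * qi) \<bullet> (h * g)" by (simp add: inner_unit_mult_left h(1))
    also have "\<dots> = (u * h) \<bullet> (f * h)" by (simp add: h(2) hg)
    also have "\<dots> = (u \<bullet> f) * (h \<bullet> h)" by (simp add: inner_quat_def algebra_simps)
    finally have "qi \<bullet> g = 0" by (simp add: uf)
    then show ?thesis by (simp add: inner_quat_def)
  qed
  have "(qIm2 g)\<^sup>2 + (qIm3 g)\<^sup>2 = 1"
    using ng g0 g1 by (simp add: inner_quat_def power2_eq_square)
  then obtain t where t: "qIm2 g = cos t" "qIm3 g = sin t"
    using sincos_total_2pi by metis
  have e: "qexp (t/2) * qi = qi * qexp (t/2)" by (simp add: quat_eq_iff)
  \<comment> \<open>Conjugation doubles angles, so turning j by \<open>t\<close> takes the half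
    angle.\<close>
  have "cos (t/2) = cos t * cos (t/2) + sin t * sin (t/2)" "sin (t/2) = sin t * cos (t/2) - cos t * sin (t/2)"
    using cos_diff[of t "t/2"] sin_diff[of t "t/2"] by simp_all
  then have "qexp (t/2) * qj = g * qexp (t/2)"
    using g0 g1 t by (simp add: quat_eq_iff)
  then have "h * qexp (t/2) * qj = f * (h * qexp (t/2))"
    by (metis hg mult.assoc)
  moreover have "h * qexp (t/2) * qi = u * (h * qexp (t/2))"
    by (metis e h(2) mult.assoc)
  ultimately show ?thesis
    using h(1) by (intro exI[of _ "h * qexp (t/2)"]) (simp add: norm_mult)
qed

lemma family_euler_arnold:
  assumes "\<delta> \<in> family1 \<union> family2 \<union> family3"
  shows "\<exists>\<eta>. euler_arnold \<delta> \<eta> \<and> smooth_map_on UNIV \<delta> \<and> \<delta> 0 = (1, 1) \<and> \<eta> 0 \<noteq> 0"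
proof -
  have circle: ?thesis if "\<delta> = (\<lambda>t. (qexp (a * t), qexp (a' * t)))" "a \<noteq> 0 \<or> a' \<noteq> 0" for a a'
  proof (intro exI conjI)
    show "euler_arnold \<delta> (\<lambda>t. (a *\<^sub>R qi, a' *\<^sub>R qi))"
      unfolding that(1) by (rule euler_arnold_circle)
    show "smooth_map_on UNIV \<delta>"
      unfolding that(1) by (intro smooth_map_on_Pair smooth_qexp)
    show "\<delta> 0 = (1, 1)" by (simp add: that(1) quat_eq_iff)
    show "(a *\<^sub>R qi, a' *\<^sub>R qi) \<noteq> 0" using that(2) by (auto simp: zero_prod_def quat_eq_iff)
  qed
  consider "\<delta> \<in> family1" | "\<delta> \<in> family2" | "\<delta> \<in> family3" using assms by blast
  then show ?thesis
  proof cases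
    case 1
    then obtain a where a: "a \<noteq> 0" "\<delta> = (\<lambda>t. (of_real (cos (a * t)) + sin (a * t) *\<^sub>R qi,
        of_real (cos (a * t)) - sin (a * t) *\<^sub>R qi))"
      unfolding family1_def by blast
    have "\<delta> = (\<lambda>t. (qexp (a * t), qexp ((- a) * t)))"
      unfolding a(2) by (simp add: fun_eq_iff quat_eq_iff)
    then show ?thesis using circle a(1) by blast
  next
    case 2
    then obtain c1 d1 a a' where c1: "c1 \<in> ImH - {0}"
      and a: "a = (1 + d1) / 2 * norm c1" "a' = (1 - d1) / 2 * norm c1"
      and \<delta>: "\<delta> = (\<lambda>t. (of_real (cos (a * t)) + sin (a * t) *\<^sub>R qi,
        of_real (cos (a' * t)) + sin (a' * t) *\<^sub>R qi))"
      unfolding family2_def by blast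
    \<comment> \<open>Both speeds cannot vanish together, although either may for suitable
      \<open>d1\<close>.\<close>
    have "a + a' = norm c1" unfolding a by (simp add: field_simps)
    then have "a \<noteq> 0 \<or> a' \<noteq> 0" using c1 by auto
    then show ?thesis using circle \<delta> unfolding qexp_eq by blast
  next
    case 3
    then obtain c1 c2 d1 a b c a' b' c' A B A' B' \<phi> \<phi>' where c: "c1 \<in> ImH - {0}" "c2 \<in> ImH - {0}"
      and a: "a = (1 + d1) / 2 * norm c1" "b = 1 / 2 * norm c2" "c = 2 / 3 * norm c1"
        "a' = (1 - d1) / 2 * norm c1" "b' = - 1 / 2 * norm c2" "c' = c"
      and A: "A = (c + sqrt ((2 * a - c)\<^sup>2 + 4 * b\<^sup>2)) / 2" "B = (c - sqrt ((2 * a - c)\<^sup>2 + 4 * b\<^sup>2)) / 2"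
        "\<phi> = (c - 2 * a + sqrt ((c - 2 * a)\<^sup>2 + 4 * b\<^sup>2)) / (2 * b)"
      and A': "A' = (c' + sqrt ((2 * a' - c')\<^sup>2 + 4 * b'\<^sup>2)) / 2" "B' = (c' - sqrt ((2 * a' - c')\<^sup>2 + 4 * b'\<^sup>2)) / 2"
        "\<phi>' = (c' - 2 * a' + sqrt ((c' - 2 * a')\<^sup>2 + 4 * b'\<^sup>2)) / (2 * b')"
      and \<delta>: "\<delta> = (\<lambda>t. (curve3 \<phi> A B t, curve3 \<phi>' A' B' t))"
      unfolding family3_def by blast
    have b: "b \<noteq> 0" "b' \<noteq> 0" "b' = - b" using c(2) by (auto simp: a)
    have sum: "c = 2 / 3 * (a + a')" unfolding a by (simp add: field_simps)
    let ?u = "\<lambda>a b t. a *\<^sub>R qi + b *\<^sub>R (cos (c * t) *\<^sub>R qj - sin (c * t) *\<^sub>R qk)"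
    have "euler_arnold \<delta> (\<lambda>t. (?u a b t, ?u a' b' t))"
      unfolding \<delta>
      by (rule euler_arnold_curve3[OF family3_constants[OF b(1) A]
            family3_constants[OF b(2) A', unfolded a(6)] b(3) sum])
    moreover have "smooth_map_on UNIV \<delta>"
      unfolding \<delta> by (intro smooth_map_on_Pair smooth_curve3)
    moreover have "\<delta> 0 = (1, 1)" by (simp add: \<delta> curve3_zero)
    moreover have "(?u a b 0, ?u a' b' 0) \<noteq> 0"
      using b(1) by (auto simp: zero_prod_def quat_eq_iff)
    ultimately show ?thesis by (intro exI conjI)
  qed
qed

section \<open>Realization of all initial velocities\<close>

lemma conj_pair_intertwine:
  assumes "norm h = 1" "h * x = u * h" "h * y = v * h"
  shows "conj_pair h (x, y) = (u, v)"
proof -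
  have "h \<noteq> 0" using assms(1) by auto
  then have "z * h * inverse h = z" for z by (simp add: mult.assoc)
  then show ?thesis by (simp add: conj_pair_def assms(2,3))
qed

lemma sgn_unit_imaginary:
  assumes "x \<noteq> 0" "qRe x = 0"
  shows "norm (sgn x) = 1" "qRe (sgn x) = 0" "norm x *\<^sub>R sgn x = x"
  using assms by (simp_all add: norm_sgn sgn_div_norm)

text \<open>Supplies the explicit curve to which a given geodesic is compared. The families fix the
  directions i and j, so they provide only the norms and angles of the two components; the rotation
  \<open>h\<close> provides the directions.\<close>

lemma initial_velocity_realized:
  assumes "\<zeta> \<in> ImH2" "\<zeta> \<noteq> 0"
  shows "\<exists>h\<in>S3. \<exists>\<delta>\<in>family1 \<union> family2 \<union> family3. \<exists>\<eta>.
    euler_arnold \<delta> \<eta> \<and> \<delta> 0 = (1, 1) \<and> conj_pair h (\<eta> 0) = \<zeta>"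
proof -
  obtain \<alpha> \<beta> where \<zeta>: "\<zeta> = (\<alpha>, \<beta>)" by fastforce
  then have im: "qRe \<alpha> = 0" "qRe \<beta> = 0" using assms(1) by (auto simp: ImH2_def ImH_def)
  define s where "s = \<alpha> + \<beta>"
  have re_s: "qRe s = 0" using im by (simp add: s_def)
  have circle: ?thesis if curve: "\<delta> \<in> family1 \<union> family2 \<union> family3" "\<delta> = (\<lambda>t. (qexp (a * t), qexp (a' * t)))"
    "norm u = 1" "qRe u = 0" "\<alpha> = a *\<^sub>R u" "\<beta> = a' *\<^sub>R u" for \<delta> a a' u
  proof -
    obtain h where h: "norm h = 1" "h * qi = u * h" using rotate_qi[OF curve(3,4)] by blast
    have "conj_pair h (a *\<^sub>R qi, a' *\<^sub>R qi) = \<zeta>"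
      unfolding \<zeta> by (rule conj_pair_intertwine) (simp_all add: h curve)
    moreover have "euler_arnold \<delta> (\<lambda>t. (a *\<^sub>R qi, a' *\<^sub>R qi))"
      unfolding curve(2) by (rule euler_arnold_circle)
    moreover have "\<delta> 0 = (1, 1)" by (simp add: curve(2) quat_eq_iff)
    moreover have "h \<in> S3" using h(1) by (simp add: S3_def)
    ultimately show ?thesis using curve(1) by blast
  qed
  show ?thesis
  proof (cases "s = 0")
    case True
    then have \<beta>: "\<beta> = - \<alpha>" by (simp add: s_def add_eq_0_iff)
    then have "\<alpha> \<noteq> 0" using assms(2) by (auto simp: \<zeta> zero_prod_def)
    define a where "a = norm \<alpha>"
    have "(\<lambda>t. (qexp (a * t), qexp ((- a) * t))) \<in> family1"
      unfolding family1_def using \<open>\<alpha> \<noteq> 0\<close>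
      by (intro CollectI exI[of _ a]) (simp add: a_def fun_eq_iff quat_eq_iff)
    then show ?thesis
      using circle[of _ a "- a" "sgn \<alpha>"] sgn_unit_imaginary[OF \<open>\<alpha> \<noteq> 0\<close> im(1)]
      by (simp add: a_def \<beta>)
  next
    case False
    \<comment> \<open>Orthogonal projection of \<alpha> - \<beta> onto \<open>s\<close>, leaving the
      remainder \<open>e\<close> orthogonal to \<open>s\<close>. The vectors \<open>s\<close> and
      \<open>e\<close> serve as witnesses for \<open>c1\<close> and \<open>c2\<close>, of which the
      families use only the norms.\<close>
    define d1 where "d1 = ((\<alpha> - \<beta>) \<bullet> s) / (s \<bullet> s)"
    define e where "e = \<alpha> - \<beta> - d1 *\<^sub>R s"
    define u where "u = sgn s"
    note u = sgn_unit_imaginary[OF False re_s, folded u_def]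
    define a where "a = (1 + d1) / 2 * norm s"
    define a' where "a' = (1 - d1) / 2 * norm s"
    have es: "e \<bullet> s = 0" using False by (simp add: e_def d1_def inner_diff_left)
    have re_e: "qRe e = 0" using im re_s by (simp add: e_def)
    have "\<alpha> = (1/2) *\<^sub>R (s + (\<alpha> - \<beta>))" "\<beta> = (1/2) *\<^sub>R (s - (\<alpha> - \<beta>))"
      by (simp_all add: s_def quat_eq_iff)
    then have "\<alpha> = ((1 + d1) / 2) *\<^sub>R s + (1/2) *\<^sub>R e" "\<beta> = ((1 - d1) / 2) *\<^sub>R s - (1/2) *\<^sub>R e"
      by (simp_all add: e_def quat_eq_iff field_simps)
    moreover have "((1 + d1) / 2) *\<^sub>R s = a *\<^sub>R u" "((1 - d1) / 2) *\<^sub>R s = a' *\<^sub>R u"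
      unfolding a_def a'_def scaleR_scaleR[symmetric] u(3) by (rule refl)+
    ultimately have \<alpha>: "\<alpha> = a *\<^sub>R u + (1/2) *\<^sub>R e" and \<beta>: "\<beta> = a' *\<^sub>R u - (1/2) *\<^sub>R e"
      by simp_all
    show ?thesis
    proof (cases "e = 0")
      case True
      have "s \<in> ImH - {0}" using False re_s by (simp add: ImH_def)
      then have "(\<lambda>t. (qexp (a * t), qexp (a' * t))) \<in> family2"
        unfolding family2_def qexp_eq[symmetric] a_def a'_def by blast
      then show ?thesis
        using circle[of _ a a' u] u \<alpha> \<beta> True by simp
    next
      case e: False
      define f where "f = sgn e"
      note f = sgn_unit_imaginary[OF e re_e, folded f_def]
      define b where "b = 1 / 2 * norm e"
      define b' where "b' = - 1 / 2 * norm e"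
      define c where "c = 2 / 3 * norm s"
      define A where "A = (c + sqrt ((2 * a - c)\<^sup>2 + 4 * b\<^sup>2)) / 2"
      define B where "B = (c - sqrt ((2 * a - c)\<^sup>2 + 4 * b\<^sup>2)) / 2"
      define \<phi> where "\<phi> = (c - 2 * a + sqrt ((c - 2 * a)\<^sup>2 + 4 * b\<^sup>2)) / (2 * b)"
      define A' where "A' = (c + sqrt ((2 * a' - c)\<^sup>2 + 4 * b'\<^sup>2)) / 2"
      define B' where "B' = (c - sqrt ((2 * a' - c)\<^sup>2 + 4 * b'\<^sup>2)) / 2"
      define \<phi>' where "\<phi>' = (c - 2 * a' + sqrt ((c - 2 * a')\<^sup>2 + 4 * b'\<^sup>2)) / (2 * b')"
      let ?\<delta> = "\<lambda>t. (curve3 \<phi> A B t, curve3 \<phi>' A' B' t)"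
      let ?u = "\<lambda>a b t. a *\<^sub>R qi + b *\<^sub>R (cos (c * t) *\<^sub>R qj - sin (c * t) *\<^sub>R qk)"
      have b: "b \<noteq> 0" "b' \<noteq> 0" "b' = - b" using e by (simp_all add: b_def b'_def)
      have sum: "c = 2 / 3 * (a + a')" unfolding a_def a'_def c_def by (simp add: field_simps)
      have ea: "euler_arnold ?\<delta> (\<lambda>t. (?u a b t, ?u a' b' t))"
        by (rule euler_arnold_curve3[OF family3_constants[OF b(1) A_def B_def \<phi>_def]
              family3_constants[OF b(2) A'_def B'_def \<phi>'_def] b(3) sum])
      have s: "s \<in> ImH - {0}" "e \<in> ImH - {0}" using False re_s e re_e by (simp_all add: ImH_def)
      have "?\<delta> \<in> family3"
        unfolding family3_def
        by (intro CollectI bexI[OF _ s(1)] bexI[OF _ s(2)] exI conjI refl)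
           (rule a_def b_def c_def a'_def b'_def A_def B_def \<phi>_def refl A'_def B'_def \<phi>'_def)+
      moreover have "u \<bullet> f = 0"
        using es by (simp add: u_def f_def sgn_div_norm inner_commute)
      then obtain h where h: "norm h = 1" "h * qi = u * h" "h * qj = f * h"
        using rotate_qi_qj u f by blast
      have "b *\<^sub>R f = (1/2) *\<^sub>R e"
        unfolding b_def scaleR_scaleR[symmetric] f(3) by (rule refl)
      then have \<alpha>': "\<alpha> = a *\<^sub>R u + b *\<^sub>R f" "\<beta> = a' *\<^sub>R u + b' *\<^sub>R f"
        unfolding \<alpha> \<beta> b(3) by simp_all
      have "conj_pair h (?u a b 0, ?u a' b' 0) = \<zeta>"
        unfolding \<zeta> \<alpha>' by (rule conj_pair_intertwine) (simp_all add: h distrib_left distrib_right)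
      moreover have "?\<delta> 0 = (1, 1)" by (simp add: curve3_zero)
      moreover have "h \<in> S3" using h(1) by (simp add: S3_def)
      ultimately show ?thesis using ea by blast
    qed
  qed
qed

lemma euler_arnold_constant: "P \<in> S3S3 \<Longrightarrow> euler_arnold (\<lambda>t. P) (\<lambda>t. 0)"
  by (simp add: euler_arnold_def linear_0[OF linear_left_translate] linear_0[OF linear_left_connection]
      ImH2_def ImH_def mem_Times_iff)

lemma conj_pair_one: "h \<in> S3 \<Longrightarrow> conj_pair h (1, 1) = (1, 1)"
  by (rule conj_pair_intertwine) (simp_all add: S3_def)

theorem theorem3p1:
  fixes \<gamma> :: "real \<Rightarrow> quat \<times> quat" and t0 :: real
  shows "geodesic_line \<gamma> \<and> \<gamma> t0 = (1, 1) \<longleftrightarrow>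
    (\<exists>h\<in>S3. \<exists>\<delta>\<in>family1 \<union> family2 \<union> family3. \<forall>t. \<gamma> (t0 + t) = conj_pair h (\<delta> t))"
proof
  assume "geodesic_line \<gamma> \<and> \<gamma> t0 = (1, 1)"
  then have geo: "geodesic S3S3 tangent_S3S3 nk_metric \<gamma>" and nc: "\<not> (\<exists>P. \<forall>t. \<gamma> t = P)"
    and init: "\<gamma> t0 = (1, 1)"
    by (auto simp: geodesic_line_def)
  obtain \<xi> where \<xi>: "euler_arnold \<gamma> \<xi>" using euler_arnold_of_geodesic[OF geo] by blast
  then have im: "\<xi> t0 \<in> ImH2" by (simp add: euler_arnold_def)
  \<comment> \<open>With zero velocity, uniqueness would identify \<gamma> with the constant
    solution, which \<open>geodesic_line\<close> excludes.\<close>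
  have "\<xi> t0 \<noteq> 0"
  proof
    assume "\<xi> t0 = 0"
    moreover have "euler_arnold (\<lambda>t. (1, 1)) (\<lambda>t. 0)"
      by (rule euler_arnold_constant) (simp add: S3S3_def S3_def)
    ultimately have "\<gamma> t = (1, 1)" for t
      using euler_arnold_unique[OF \<xi>] init by metis
    then show False using nc by blast
  qed
  then obtain h \<delta> \<eta> where h: "h \<in> S3" and \<delta>: "\<delta> \<in> family1 \<union> family2 \<union> family3"
    and \<eta>: "euler_arnold \<delta> \<eta>" "\<delta> 0 = (1, 1)" "conj_pair h (\<eta> 0) = \<xi> t0"
    using initial_velocity_realized[OF im] by blast
  have "\<gamma> (t0 + t) = conj_pair h (\<delta> (t0 + t - t0))" for t
    by (rule euler_arnold_unique[OF \<xi> euler_arnold_conj_shift[OF h \<eta>(1), of t0], of t0])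
       (simp_all add: init \<eta>(2,3) conj_pair_one[OF h])
  then show "\<exists>h\<in>S3. \<exists>\<delta>\<in>family1 \<union> family2 \<union> family3. \<forall>t. \<gamma> (t0 + t) = conj_pair h (\<delta> t)"
    using h \<delta> by auto
next
  assume "\<exists>h\<in>S3. \<exists>\<delta>\<in>family1 \<union> family2 \<union> family3. \<forall>t. \<gamma> (t0 + t) = conj_pair h (\<delta> t)"
  then obtain h \<delta> where h: "h \<in> S3" and \<delta>: "\<delta> \<in> family1 \<union> family2 \<union> family3"
    and eq: "\<And>t. \<gamma> (t0 + t) = conj_pair h (\<delta> t)" by blast
  obtain \<eta> where \<eta>: "euler_arnold \<delta> \<eta>" and sm: "smooth_map_on UNIV \<delta>"
    and init: "\<delta> 0 = (1, 1)" "\<eta> 0 \<noteq> 0"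
    using family_euler_arnold[OF \<delta>] by blast
  have \<gamma>: "\<gamma> = (\<lambda>t. conj_pair h (\<delta> (t - t0)))"
    using eq[of "t - t0" for t] by (simp add: fun_eq_iff)
  have ea: "euler_arnold \<gamma> (\<lambda>t. conj_pair h (\<eta> (t - t0)))"
    unfolding \<gamma> by (rule euler_arnold_conj_shift[OF h \<eta>])
  have "smooth_map_on UNIV \<gamma>"
    unfolding \<gamma> by (intro smooth_map_on_bounded_linear[OF bounded_linear_conj_pair] smooth_map_on_shift sm)
  then have "geodesic S3S3 tangent_S3S3 nk_metric \<gamma>" using geodesic_of_euler_arnold ea by blast
  \<comment> \<open>Conjugation by a unit is injective, so the velocity at \<open>t0\<close> stays
    nonzero and the curve cannot be constant.\<close>
  moreover have "conj_pair h (\<eta> 0) \<noteq> 0"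
    using h init(2) by (cases "\<eta> 0") (auto simp: conj_pair_def zero_prod_def S3_def)
  then have "\<not> (\<exists>P. \<forall>t. \<gamma> t = P)"
    using euler_arnold_nonconstant[OF ea, of t0] by simp
  moreover have "\<gamma> t0 = (1, 1)" using eq[of 0] init(1) conj_pair_one[OF h] by simp
  ultimately show "geodesic_line \<gamma> \<and> \<gamma> t0 = (1, 1)" by (simp add: geodesic_line_def)
qed

end
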